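(* Let $(X,\mathcal B,\mu)$ be a separable probability space and let $T:X\to X$ be an invertible $\mu$-preserving transformation. Let $\ell\geq 1$ and let $p_j,q_j$, $j=0,1,\dots,\ell$, be integers such that $p_0=q_0=0$, $p_j\ne 0$ if $j\ne 0$, and $p_1<p_2<\dots<p_\ell$. Then for any $A\in\mathcal B$ with $\mu(A)>0$ there exists an infinite subset $\mathcal N_A\subset\mathbb N$ of positive integers with uniformly bounded gaps such that $$\liminf_{N\to\infty,\ N\in\mathcal N_A}\frac 1N\sum_{n=1}^N\mu\Big(\bigcap_{j=0}^\ell T^{-(p_jn+q_jN)}A\Big)>0.$$
   Context: An infinite set of positive integers has uniformly bounded gaps if the differences between its consecutive elements are bounded by a constant. *)

theory Defs
  imports "HOL-Probability.Probability"
begin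

(* Separability of the measure algebra: the measurable sets with the pseudometric
   "measure of the symmetric difference" have a countable dense subset.  For finite measures
   this is the same as separability of L^2, and weaker than the sigma-algebra being
   countably generated. *)
definition separable_measure :: "'a measure \<Rightarrow> bool" where
  "separable_measure M \<longleftrightarrow>
     (\<exists>D \<subseteq> sets M. countable D \<and>
        (\<forall>A \<in> sets M. \<forall>\<epsilon>>0. \<exists>B \<in> D. emeasure M (sym_diff A B) < \<epsilon>))"

definition invertible_measure_preserving :: "'a measure \<Rightarrow> ('a \<Rightarrow> 'a) \<Rightarrow> bool" where
  "invertible_measure_preserving M T \<longleftrightarrow>
     bij_betw T (space M) (space M) \<and>
     T \<in> measurable M M \<and>
     the_inv_into (space M) T \<in> measurable M M \<and>
     (\<forall>A \<in> sets M. emeasure M (T -` A \<inter> space M) = emeasure M A)"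

(* The integer power T^k of a bijection T of X; meaningful only at points of X. *)
definition int_iterate :: "'a set \<Rightarrow> ('a \<Rightarrow> 'a) \<Rightarrow> int \<Rightarrow> 'a \<Rightarrow> 'a" where
  "int_iterate X T k =
     (if k \<ge> 0 then T ^^ nat k else the_inv_into X T ^^ nat (- k))"

(* T^(-k) A, as the preimage of A under T^k. *)
definition shifted_set :: "'a measure \<Rightarrow> ('a \<Rightarrow> 'a) \<Rightarrow> int \<Rightarrow> 'a set \<Rightarrow> 'a set" where
  "shifted_set M T k A = int_iterate (space M) T k -` A \<inter> space M"

definition uniformly_bounded_gaps :: "nat set \<Rightarrow> bool" where
  "uniformly_bounded_gaps S \<longleftrightarrow>
     (\<exists>C. \<forall>a \<in> S. \<forall>b \<in> S. a < b \<and> S \<inter> {a<..<b} = {} \<longrightarrow> b - a \<le> C)"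

end

theory Submission
  imports Defs
begin

text \<open>
  With all q j = 0 and p j = j the theorem yields Furstenberg's multiple recurrence, and hence
  Szemeredi's theorem, so its core is combinatorial. Everything rests on the density Hales-Jewett
  theorem: for large n, a set of words of length n over the alphabet {0,...,k-1} that has positive
  density contains a combinatorial line.

  Let the letters be the indices j = 0,...,l and fix numbers u i and v i for i < m. Send a word w to
  the integer \<phi>(w), the sum over i of p (w i) (u i) + q (w i) (v i). Along a line with wildcard set S,
  \<phi> takes the values c + p j U + q j V, where U and V are the sums of u and of v over S. The sets
  T^(-\<phi>(w)) A all have measure \<mu>(A), so the density theorem yields a line on which their
  intersection has measure at least \<theta>, where m and \<theta> depend on \<mu>(A) and l only
  (\<open>recurrence_along_finite_sums\<close>). Hence, whatever u and v are, some nonempty S makes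
  F(n,N), the measure of the intersection of the T^(-(p j n + q j N)) A, at least \<theta>
  at n = U and N = V.

  Call N good if the mean of F(n,N) over n \<le> N is at least \<theta> / 2^(m+2). If the good N
  did not meet every interval of some fixed length, then arbitrarily long intervals of bad N would
  exist. One could choose v 0, v 1, ... one after the other so that all their finite sums are bad, and
  along with them u 0, u 1, ... such that F < \<theta> at all finite sums, because for a bad N only few n
  have F(n,N) \<ge> \<theta>. This contradicts the previous paragraph
  (\<open>syndetic_from_finite_sums\<close>).

  The density Hales-Jewett theorem is proved by induction on k, following the argument of Dodos,
  Kanellopoulos and Tyros. Let \<delta> be the limiting density of line-free sets over k + 1 letters and
  suppose that \<delta> > 0. A set of k points x(0),...,x(k-1) obtained from a word x by replacing its
  letters k is a line over k letters, and x itself is the point that completes it to a line over k + 1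
  letters. If a line-free set A contains many such k-point lines, then the words x that describe
  them form a dense set D that A avoids, up to few words. Being an intersection of sets that are insensitive to changing k
  into one other letter, D has a complement that can be tiled by subspaces
  (\<open>tile_intersection\<close>, which uses the induction hypothesis), and A has density about \<delta> at
  most on each of them. So A has density below \<delta> (\<open>line_free_density_bound\<close>).
  To find many such lines, view long words as pairs of a short and a long word. All fibres of a nearly extremal
  set have density near \<delta>, so the case of k letters makes some line of short words
  good, in the sense that its points have many common continuations in A, and the Graham-Rothschild theorem
  for variable words (\<open>graham_rothschild\<close>) gives a subspace of short words in which all lines are good
  (\<open>good_subspace\<close>). Averaging over the continuations gives the contradiction in
  \<open>density_hales_jewett_Suc\<close>.
\<close>

section \<open>Words, templates and means\<close>

definition words :: "nat \<Rightarrow> nat \<Rightarrow> nat list set" where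
  "words k n = {x. length x = n \<and> set x \<subseteq> {..<k}}"

text \<open>An m-dimensional combinatorial subspace of the words of length n: an entry Inl a is
  the fixed letter a, an entry Inr j stands for the j-th coordinate. Each coordinate has to occur,
  so that \<open>inst\<close> is injective and a template with one coordinate is a combinatorial
  line. The bound k only restricts the fixed letters. The coordinates may be instantiated by
  larger letters; this is how a subspace over k letters becomes one over k + 1 letters.\<close>

definition template :: "nat \<Rightarrow> nat \<Rightarrow> nat \<Rightarrow> (nat + nat) list \<Rightarrow> bool" where
  "template k m n t \<longleftrightarrow> length t = n \<and> set t \<subseteq> Inl ` {..<k} \<union> Inr ` {..<m} \<and> Inr ` {..<m} \<subseteq> set t"

definition inst :: "(nat + nat) list \<Rightarrow> nat list \<Rightarrow> nat list" where
  "inst t x = map (case_sum id ((!) x)) t"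

definition shift_vars :: "nat \<Rightarrow> (nat + nat) list \<Rightarrow> (nat + nat) list" where
  "shift_vars m t = map (map_sum id ((+) m)) t"

definition comp_template :: "(nat + nat) list \<Rightarrow> (nat + nat) list \<Rightarrow> (nat + nat) list" where
  "comp_template t s = map (case_sum Inl ((!) s)) t"

definition mean :: "nat \<Rightarrow> nat \<Rightarrow> (nat list \<Rightarrow> real) \<Rightarrow> real" where
  "mean k n f = (\<Sum>x\<in>words k n. f x) / real (k ^ n)"

lemma finite_words [simp]: "finite (words k n)"
  using finite_lists_length_eq[of "{..<k}" n] by (simp add: words_def conj_commute)

lemma card_words [simp]: "card (words k n) = k ^ n"
  using card_lists_length_eq[of "{..<k}" n] by (simp add: words_def conj_commute)

lemma words_0 [simp]: "words k 0 = {[]}"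
  by (auto simp: words_def)

lemma length_words: "x \<in> words k n \<Longrightarrow> length x = n"
  by (simp add: words_def)

lemma words_mono: "k \<le> k' \<Longrightarrow> words k n \<subseteq> words k' n"
  by (auto simp: words_def)

lemma nth_words: "x \<in> words k n \<Longrightarrow> i < n \<Longrightarrow> x ! i < k"
  by (auto simp: words_def subset_iff)

lemma Cons_in_words [simp]: "a # x \<in> words k (Suc n) \<longleftrightarrow> a < k \<and> x \<in> words k n"
  by (auto simp: words_def)

lemma words_1_iff: "x \<in> words k (Suc 0) \<longleftrightarrow> (\<exists>a<k. x = [a])"
  by (auto simp: words_def length_Suc_conv)

lemma append_in_words: "x \<in> words k m \<Longrightarrow> y \<in> words k n \<Longrightarrow> x @ y \<in> words k (m + n)"
  by (auto simp: words_def)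

lemma words_splitE:
  assumes "z \<in> words k (m + n)"
  obtains x y where "z = x @ y" "x \<in> words k m" "y \<in> words k n"
proof
  show "z = take m z @ drop m z" by simp
  show "take m z \<in> words k m" "drop m z \<in> words k n"
    using assms set_take_subset[of m z] set_drop_subset[of m z] by (auto simp: words_def)
qed

lemma words_SucE:
  assumes "z \<in> words k (Suc n)"
  obtains a x where "z = a # x" "a < k" "x \<in> words k n"
  using assms by (cases z) (auto simp: words_def)

lemma sum_words_append:
  "(\<Sum>z\<in>words k (m + n). f z) = (\<Sum>x\<in>words k m. \<Sum>y\<in>words k n. f (x @ y))"
proof -
  have "(\<Sum>z\<in>words k (m + n). f z) = (\<Sum>(x, y)\<in>words k m \<times> words k n. f (x @ y))"
  proof (rule sum.reindex_bij_witness[where i = "\<lambda>(x, y). x @ y" and j = "\<lambda>z. (take m z, drop m z)"])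
    fix z assume z: "z \<in> words k (m + n)"
    then show "(take m z, drop m z) \<in> words k m \<times> words k n"
      by (elim words_splitE) (auto simp: length_words)
  qed (auto simp: length_words append_in_words)
  then show ?thesis by (simp add: sum.cartesian_product)
qed

lemma mean_append: "mean k (m + n) f = mean k m (\<lambda>x. mean k n (\<lambda>y. f (x @ y)))"
  by (simp add: mean_def sum_words_append power_add sum_divide_distrib divide_divide_eq_left mult.commute)

lemma mean_swap:
  "mean k m (\<lambda>x. mean k' n (\<lambda>y. f x y)) = mean k' n (\<lambda>y. mean k m (\<lambda>x. f x y))"
  unfolding mean_def sum_divide_distrib[symmetric]
  by (subst sum.swap) (simp add: mult.commute)

lemma words_Suc_0: "words k (Suc 0) = (\<lambda>a. [a]) ` {..<k}"
  by (auto simp: words_1_iff)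

lemma mean_Suc: "mean k (Suc n) f = (\<Sum>a<k. mean k n (\<lambda>x. f (a # x))) / real k"
  using mean_append[of k "Suc 0" n f]
  by (simp add: mean_def words_Suc_0 sum.reindex inj_on_def)

lemma mean_0 [simp]: "mean k 0 f = f []"
  by (simp add: mean_def)

lemma mean_const [simp]: "k > 0 \<Longrightarrow> mean k n (\<lambda>_. c) = c"
  by (simp add: mean_def)

lemma mean_add: "mean k n (\<lambda>x. f x + g x) = mean k n f + mean k n g"
  by (simp add: mean_def sum.distrib add_divide_distrib)

lemma mean_diff: "mean k n (\<lambda>x. f x - g x) = mean k n f - mean k n g"
  by (simp add: mean_def sum_subtractf diff_divide_distrib)

lemma mean_cmult: "mean k n (\<lambda>x. c * f x) = c * mean k n f"
  by (simp add: mean_def sum_distrib_left)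

lemma mean_sum: "mean k n (\<lambda>x. \<Sum>i\<in>I. f i x) = (\<Sum>i\<in>I. mean k n (f i))"
  unfolding mean_def by (subst sum.swap) (simp add: sum_divide_distrib)

lemma mean_mono:
  assumes "\<And>x. x \<in> words k n \<Longrightarrow> f x \<le> g x"
  shows "mean k n f \<le> mean k n g"
  unfolding mean_def by (intro divide_right_mono sum_mono assms) auto

lemma mean_cong:
  assumes "\<And>x. x \<in> words k n \<Longrightarrow> f x = g x"
  shows "mean k n f = mean k n g"
  unfolding mean_def by (simp add: assms cong: sum.cong)

lemma mean_nonneg: "(\<And>x. x \<in> words k n \<Longrightarrow> 0 \<le> f x) \<Longrightarrow> 0 \<le> mean k n f"
  unfolding mean_def by (intro divide_nonneg_nonneg sum_nonneg) auto

lemma mean_le_const: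
  assumes "k > 0" "\<And>x. x \<in> words k n \<Longrightarrow> f x \<le> c"
  shows "mean k n f \<le> c"
  using mean_mono[of k n f "\<lambda>_. c"] assms by simp

lemma mean_gtE:
  assumes "k > 0" "mean k n f > c"
  obtains x where "x \<in> words k n" "f x > c"
  using mean_le_const[OF assms(1), of n f c] assms(2) by (meson not_le)

lemma mean_ge_point:
  assumes "x \<in> words k n" "\<And>y. y \<in> words k n \<Longrightarrow> 0 \<le> f y"
  shows "f x / real (k ^ n) \<le> mean k n f"
  unfolding mean_def using assms by (intro divide_right_mono member_le_sum) auto

lemma mean_nonpos_iff: "k > 0 \<Longrightarrow> mean k n f \<le> 0 \<longleftrightarrow> (\<Sum>x\<in>words k n. f x) \<le> 0"
  unfolding mean_def using zero_less_power[of k n]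
  by (simp add: divide_le_0_iff del: zero_less_power of_nat_power)

lemma indicat_Collect: "indicat_real {x. P x} = (\<lambda>x. of_bool (P x))"
  by (auto simp: indicator_def)

lemma length_inst [simp]: "length (inst t x) = length t"
  by (simp add: inst_def)

lemma templateD:
  assumes "template k m n t"
  shows "length t = n" "Inl a \<in> set t \<Longrightarrow> a < k" "Inr j \<in> set t \<Longrightarrow> j < m" "j < m \<Longrightarrow> Inr j \<in> set t"
  using assms by (auto simp: template_def)

lemma template_mono:
  assumes "template k m n t" "k \<le> k'"
  shows "template k' m n t"
proof -
  have "Inl ` {..<k} \<subseteq> Inl ` {..<k'}" using assms(2) by auto
  then show ?thesis using assms(1) unfolding template_def by blast
qed

lemma finite_templates [simp]: "finite {t. template k m n t}"
  by (rule finite_subset[OF _ finite_lists_length_eq[of "Inl ` {..<k} \<union> Inr ` {..<m}" n]])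
     (auto simp: template_def)

lemma inst_in_words:
  assumes t: "template k m n t" and "k \<le> k'" and x: "x \<in> words k' m"
  shows "inst t x \<in> words k' n"
proof -
  have "case_sum id ((!) x) v < k'" if "v \<in> set t" for v
  proof (cases v)
    case (Inl a)
    with that templateD(2)[OF t, of a] \<open>k \<le> k'\<close> show ?thesis by simp
  next
    case (Inr j)
    with that templateD(3)[OF t, of j] nth_words[OF x, of j] show ?thesis by simp
  qed
  then show ?thesis using templateD(1)[OF t] by (auto simp: words_def inst_def)
qed

lemma var_value_in_inst:
  assumes "template k m n t" "length x = m"
  shows "set x \<subseteq> set (inst t x)"
proof
  fix a assume "a \<in> set x"
  then obtain j where "j < m" "x ! j = a" using assms(2) by (auto simp: in_set_conv_nth)
  then show "a \<in> set (inst t x)"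
    using templateD(4)[OF assms(1), of j] by (force simp: inst_def)
qed

lemma inst_inj:
  assumes "template k m n t" "length x = m" "length y = m" "inst t x = inst t y"
  shows "x = y"
proof (rule nth_equalityI)
  fix j assume "j < length x"
  then have "Inr j \<in> set t" using templateD(4)[OF assms(1)] assms(2) by auto
  then show "x ! j = y ! j" using assms(4) by (auto simp: inst_def map_eq_conv)
qed (use assms in simp)

lemma inst_comp:
  assumes "template k m n t" "length s = m"
  shows "inst (comp_template t s) x = inst t (inst s x)"
  unfolding inst_def comp_template_def map_map
proof (rule map_cong[OF refl])
  fix v assume v: "v \<in> set t"
  show "(case_sum id ((!) x) \<circ> case_sum Inl ((!) s)) v = case_sum id ((!) (map (case_sum id ((!) x)) s)) v"
  proof (cases v)
    case (Inr j)
    with v templateD(3)[OF assms(1), of j] assms(2) show ?thesis by simp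
  qed simp
qed

lemma template_comp:
  assumes t: "template k m n t" and s: "template k l m s"
  shows "template k l n (comp_template t s)"
proof -
  have "case_sum Inl ((!) s) v \<in> Inl ` {..<k} \<union> Inr ` {..<l}" if "v \<in> set t" for v
  proof (cases v)
    case (Inr j)
    then have "s ! j \<in> set s" using templateD(3)[OF t] that templateD(1)[OF s] by auto
    then show ?thesis using s Inr by (auto simp: template_def)
  qed (use templateD(2)[OF t] that in auto)
  moreover have "Inr j \<in> set (comp_template t s)" if "j < l" for j
  proof -
    obtain i where "i < m" "s ! i = Inr j"
      using templateD(1,4)[OF s] \<open>j < l\<close> by (metis in_set_conv_nth)
    then show ?thesis
      using templateD(4)[OF t, of i] by (force simp: comp_template_def)
  qed
  ultimately show ?thesis using templateD(1)[OF t] by (auto simp: template_def comp_template_def)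
qed

lemma inst_append: "inst (t @ s) x = inst t x @ inst s x"
  by (simp add: inst_def)

lemma inst_const [simp]: "inst (map Inl w) x = w"
  by (simp add: inst_def comp_def)

lemma inst_Nil [simp]: "inst [] x = []"
  by (simp add: inst_def)

lemma inst_shift:
  assumes "length x = m"
  shows "inst (shift_vars m s) (x @ y) = inst s y"
  unfolding inst_def shift_vars_def map_map
proof (rule map_cong[OF refl])
  fix v show "(case_sum id ((!) (x @ y)) \<circ> map_sum id ((+) m)) v = case_sum id ((!) y) v"
    using assms by (cases v) (simp_all add: nth_append)
qed

lemma inst_prod:
  assumes "template k m n t" "length x = m"
  shows "inst (t @ shift_vars m s) (x @ y) = inst t x @ inst s y"
proof -
  have "inst t (x @ y) = inst t x"
    unfolding inst_def
  proof (rule map_cong[OF refl])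
    fix v assume v: "v \<in> set t"
    show "case_sum id ((!) (x @ y)) v = case_sum id ((!) x) v"
    proof (cases v)
      case (Inr j)
      with v templateD(3)[OF assms(1), of j] assms(2) show ?thesis by (simp add: nth_append)
    qed simp
  qed
  then show ?thesis by (simp add: inst_append inst_shift assms)
qed

lemma template_prod:
  assumes "template k m n t" "template k m' n' s"
  shows "template k (m + m') (n + n') (t @ shift_vars m s)"
proof -
  have "Inr j \<in> set (t @ shift_vars m s)" if "j < m + m'" for j
  proof (cases "j < m")
    case False
    then have "Inr (j - m) \<in> set s" using templateD(4)[OF assms(2)] that by auto
    then have "map_sum id ((+) m) (Inr (j - m)) \<in> set (shift_vars m s)"
      unfolding shift_vars_def by (auto simp del: map_sum.simps)
    then show ?thesis using False by simp
  qed (use templateD(4)[OF assms(1)] in auto)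
  moreover have "map_sum id ((+) m) v \<in> Inl ` {..<k} \<union> Inr ` {..<m + m'}" if "v \<in> set s" for v
  proof (cases v)
    case (Inl a)
    with that templateD(2)[OF assms(2), of a] show ?thesis by simp
  next
    case (Inr j)
    with that templateD(3)[OF assms(2), of j] show ?thesis by simp
  qed
  then have "set (t @ shift_vars m s) \<subseteq> Inl ` {..<k} \<union> Inr ` {..<m + m'}"
    using assms(1) by (auto simp: template_def shift_vars_def)
  moreover have "length (t @ shift_vars m s) = n + n'"
    using assms by (simp add: template_def shift_vars_def)
  ultimately show ?thesis unfolding template_def by blast
qed

lemma template_const: "w \<in> words k n \<Longrightarrow> template k 0 n (map Inl w)"
  by (auto simp: template_def words_def)

lemma shift_vars_const [simp]: "shift_vars m (map Inl y) = map Inl y"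
  by (simp add: shift_vars_def)

lemma shift_vars_0 [simp]: "shift_vars 0 t = t"
proof -
  have "map_sum id ((+) 0) = (id :: nat + nat \<Rightarrow> _)"
    using sum.map_id0 by (metis add_0 eq_id_iff)
  then show ?thesis by (simp add: shift_vars_def)
qed

lemma template_append_const:
  "template k m n t \<Longrightarrow> y \<in> words k n' \<Longrightarrow> template k m (n + n') (t @ map Inl y)"
  using template_prod[OF _ template_const, of k m n t y n'] by simp

lemma template_prepend_const:
  "template k m n t \<Longrightarrow> y \<in> words k n' \<Longrightarrow> template k m (n' + n) (map Inl y @ t)"
  using template_prod[OF template_const, of y k n' m n t] by simp

lemma inst_append_const [simp]: "inst (t @ map Inl y) x = inst t x @ y"
  "inst (map Inl y @ t) x = y @ inst t x"
  by (simp_all add: inst_append)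

lemma template_new_var:
  "template k m n t \<Longrightarrow> template k (Suc m) (Suc n) (Inr 0 # shift_vars (Suc 0) t)"
  using template_prod[of k 1 1 "[Inr 0]" m n t] by (simp add: template_def lessThan_Suc)

lemma inst_new_var [simp]: "inst (Inr 0 # shift_vars (Suc 0) t) (a # x) = a # inst t x"
  using inst_prod[of 1 1 1 "[Inr 0]" "[a]" t x] by (simp add: template_def inst_def lessThan_Suc)

lemma template_initial:
  assumes "0 < k" "m \<le> n"
  obtains t where "template k m n t"
proof
  show "template k m n (map Inr [0..<m] @ replicate (n - m) (Inl 0))"
    using assms by (auto simp: template_def)
qed

section \<open>Colourings: Hales-Jewett and a Graham-Rothschild theorem for variable words\<close>

text \<open>A common form of several Ramsey theorems: every finite colouring of long words has a
  subspace in which the pairs in R get equal colours. With all pairs this is the Hales-Jewett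
  theorem. With k' = k + 1 and the pairs of words containing the letter k it speaks of variable
  words: the letter k is the variable, and the fixed letters of the subspace must differ from
  it.\<close>

definition ramsey :: "nat \<Rightarrow> nat \<Rightarrow> nat \<Rightarrow> (nat list \<times> nat list) set \<Rightarrow> bool" where
  "ramsey k k' m R \<longleftrightarrow> (\<forall>r. \<exists>n. \<forall>c. (\<forall>x\<in>words k' n. c x < (r::nat)) \<longrightarrow>
     (\<exists>t. template k m n t \<and> (\<forall>(x, y)\<in>R. c (inst t x) = c (inst t y))))"

lemma ramseyD:
  assumes "ramsey k k' m R"
  shows "\<exists>n. \<forall>c. (\<forall>x\<in>words k' n. c x < (r::nat)) \<longrightarrow>
     (\<exists>t. template k m n t \<and> (\<forall>(x, y)\<in>R. c (inst t x) = c (inst t y)))"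
  using assms unfolding ramsey_def by blast

text \<open>Finitely many colourings form a single one, with tuples as colours.\<close>

lemma ramsey_simultaneous:
  assumes R: "ramsey k k' m R" and "k \<le> k'" "R \<subseteq> words k' m \<times> words k' m" and B: "finite B"
  shows "\<exists>n. \<forall>c. (\<forall>b\<in>B. \<forall>x\<in>words k' n. c b x < (r::nat)) \<longrightarrow>
     (\<exists>t. template k m n t \<and> (\<forall>b\<in>B. \<forall>(x, y)\<in>R. c b (inst t x) = c b (inst t y)))"
proof -
  define F where "F = (B \<rightarrow>\<^sub>E {..<r})"
  have F: "finite F" unfolding F_def by (intro finite_PiE B) auto
  then obtain e where e: "bij_betw e F {..<card F}"
    using ex_bij_betw_finite_nat[of F] atLeast0LessThan by metis
  obtain n where n: "\<forall>c. (\<forall>x\<in>words k' n. c x < card F) \<longrightarrow>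
     (\<exists>t. template k m n t \<and> (\<forall>(x, y)\<in>R. c (inst t x) = c (inst t y)))"
    using ramseyD[OF R] by blast
  show ?thesis
  proof (rule exI[of _ "n"], intro allI impI)
    fix c assume c: "\<forall>b\<in>B. \<forall>x\<in>words k' n. c b x < r"
    define c' where "c' x = restrict (\<lambda>b. c b x) B" for x
    have c'F: "c' x \<in> F" if "x \<in> words k' n" for x
      using c that by (auto simp: F_def c'_def)
    have "\<forall>x\<in>words k' n. e (c' x) < card F"
      using bij_betwE[OF e] c'F by auto
    from n[rule_format, of "\<lambda>x. e (c' x)", OF this[rule_format]] obtain t where
      t: "template k m n t" "\<forall>(x, y)\<in>R. e (c' (inst t x)) = e (c' (inst t y))" by auto
    have "c b (inst t x) = c b (inst t y)" if "b \<in> B" "(x, y) \<in> R" for b x y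
    proof -
      have "x \<in> words k' m" "y \<in> words k' m" using that assms(3) by auto
      then have "c' (inst t x) \<in> F" "c' (inst t y) \<in> F"
        by (auto intro!: c'F inst_in_words[OF t(1) \<open>k \<le> k'\<close>])
      moreover have "e (c' (inst t x)) = e (c' (inst t y))" using t(2) that by auto
      ultimately have "c' (inst t x) = c' (inst t y)"
        using e by (auto simp: bij_betw_def inj_on_def)
      then show ?thesis using that(1) by (metis c'_def restrict_apply')
    qed
    then show "\<exists>t. template k m n t \<and> (\<forall>b\<in>B. \<forall>(x, y)\<in>R. c b (inst t x) = c b (inst t y))"
      using t(1) by blast
  qed
qed

text \<open>Words are split in a head of length n1 and a tail of length n2. The head length is
  chosen first, since it need only cope with the finitely many tails inside the final subspace;
  then the tail is chosen for all heads of length n1 simultaneously. In the proof the tail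
  subspace is found before the head subspace.\<close>

lemma ramsey_product:
  assumes R1: "ramsey k k' m1 R1" "R1 \<subseteq> words k' m1 \<times> words k' m1"
    and R2: "ramsey k k' m2 R2" "R2 \<subseteq> words k' m2 \<times> words k' m2" and "k \<le> k'"
  shows "ramsey k k' (m1 + m2) {(x @ x', y @ y') | x y x' y'. (x, y) \<in> R1 \<and> (x', y') \<in> R2}"
  unfolding ramsey_def
proof
  fix r :: nat
  obtain n1 where n1: "\<forall>c. (\<forall>b\<in>words k' m2. \<forall>x\<in>words k' n1. c b x < r) \<longrightarrow>
     (\<exists>t. template k m1 n1 t \<and> (\<forall>b\<in>words k' m2. \<forall>(x, y)\<in>R1. c b (inst t x) = c b (inst t y)))"
    using ramsey_simultaneous[OF R1(1) \<open>k \<le> k'\<close> R1(2) finite_words] by blast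
  obtain n2 where n2: "\<forall>c. (\<forall>b\<in>words k' n1. \<forall>x\<in>words k' n2. c b x < r) \<longrightarrow>
     (\<exists>t. template k m2 n2 t \<and> (\<forall>b\<in>words k' n1. \<forall>(x, y)\<in>R2. c b (inst t x) = c b (inst t y)))"
    using ramsey_simultaneous[OF R2(1) \<open>k \<le> k'\<close> R2(2) finite_words] by blast
  show "\<exists>n. \<forall>c. (\<forall>x\<in>words k' n. c x < r) \<longrightarrow> (\<exists>t. template k (m1 + m2) n t \<and>
     (\<forall>(x, y)\<in>{(x @ x', y @ y') | x y x' y'. (x, y) \<in> R1 \<and> (x', y') \<in> R2}. c (inst t x) = c (inst t y)))"
  proof (rule exI[of _ "n1 + n2"], intro allI impI)
    fix c assume c: "\<forall>x\<in>words k' (n1 + n2). c x < r"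
    obtain t2 where t2: "template k m2 n2 t2"
      "\<forall>b\<in>words k' n1. \<forall>(x, y)\<in>R2. c (b @ inst t2 x) = c (b @ inst t2 y)"
      using n2[rule_format, of "\<lambda>b x. c (b @ x)"] c append_in_words by blast
    have "c (b @ inst t2 x) < r" if "x \<in> words k' m2" "b \<in> words k' n1" for b x
      using c append_in_words[OF that(2) inst_in_words[OF t2(1) \<open>k \<le> k'\<close> that(1)]] by blast
    then obtain t1 where t1: "template k m1 n1 t1"
      "\<forall>b\<in>words k' m2. \<forall>(x, y)\<in>R1. c (inst t1 x @ inst t2 b) = c (inst t1 y @ inst t2 b)"
      using n1[rule_format, of "\<lambda>b x. c (x @ inst t2 b)"] by blast
    have "c (inst (t1 @ shift_vars m1 t2) (x @ x')) = c (inst (t1 @ shift_vars m1 t2) (y @ y'))"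
      if "(x, y) \<in> R1" "(x', y') \<in> R2" for x y x' y'
    proof -
      have w: "x \<in> words k' m1" "y \<in> words k' m1" "x' \<in> words k' m2" "y' \<in> words k' m2"
        using that R1(2) R2(2) by auto
      have "c (inst t1 x @ inst t2 x') = c (inst t1 x @ inst t2 y')"
        using t2(2) that(2) inst_in_words[OF t1(1) \<open>k \<le> k'\<close> w(1)] by blast
      also have "\<dots> = c (inst t1 y @ inst t2 y')"
        using t1(2) that(1) w(4) by blast
      finally show ?thesis using w by (simp add: inst_prod[OF t1(1)] length_words)
    qed
    then have "\<forall>(x, y)\<in>{(x @ x', y @ y') | x y x' y'. (x, y) \<in> R1 \<and> (x', y') \<in> R2}.
        c (inst (t1 @ shift_vars m1 t2) x) = c (inst (t1 @ shift_vars m1 t2) y)"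
      by clarify
    with template_prod[OF t1(1) t2(1)] show "\<exists>t. template k (m1 + m2) (n1 + n2) t \<and>
      (\<forall>(x, y)\<in>{(x @ x', y @ y') | x y x' y'. (x, y) \<in> R1 \<and> (x', y') \<in> R2}. c (inst t x) = c (inst t y))"
      by blast
  qed
qed

lemma ramsey_subset: "ramsey k k' m R \<Longrightarrow> R' \<subseteq> R \<Longrightarrow> ramsey k k' m R'"
  unfolding ramsey_def
  by (erule all_forward, erule ex_forward, erule all_forward, erule imp_forward, assumption,
      erule ex_forward, erule conj_forward, assumption) blast

lemma ramsey_0: "ramsey k k' 0 {([], [])}"
  unfolding ramsey_def
  by (intro allI exI[of _ 0] impI exI[of _ "[]"]) (auto simp: template_def)

lemma ramsey_power:
  assumes E: "ramsey k k' 1 {([a], [b]) | a b. E a b}" and "k \<le> k'"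
    and E': "\<And>a b. E a b \<Longrightarrow> a < k' \<and> b < k'"
  shows "ramsey k k' m {(x, y). length x = m \<and> list_all2 E x y}"
proof (induction m)
  case 0
  show ?case by (rule ramsey_subset[OF ramsey_0]) auto
next
  case (Suc m)
  have *: "list_all2 E x y \<Longrightarrow> x \<in> words k' (length x) \<and> y \<in> words k' (length x)" for x y
    by (induction rule: list_all2_induct) (use E' in auto)
  have "ramsey k k' (1 + m) {(x @ x', y @ y') | x y x' y'.
      (x, y) \<in> {([a], [b]) | a b. E a b} \<and> (x', y') \<in> {(x, y). length x = m \<and> list_all2 E x y}}"
  proof (rule ramsey_product[OF E _ Suc _ \<open>k \<le> k'\<close>])
    show "{([a], [b]) | a b. E a b} \<subseteq> words k' 1 \<times> words k' 1"
      using E' by auto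
    show "{(x, y). length x = m \<and> list_all2 E x y} \<subseteq> words k' m \<times> words k' m"
      using * by auto
  qed
  moreover have "{(x, y). length x = Suc m \<and> list_all2 E x y} \<subseteq> {(x @ x', y @ y') | x y x' y'.
      (x, y) \<in> {([a], [b]) | a b. E a b} \<and> (x', y') \<in> {(x, y). length x = m \<and> list_all2 E x y}}"
    apply (clarsimp simp: length_Suc_conv list_all2_Cons1)
    subgoal for a x b y by (intro exI[of _ "[a]"] exI[of _ x] exI[of _ "[b]"] exI[of _ y]) auto
    done
  ultimately have "ramsey k k' (1 + m) {(x, y). length x = Suc m \<and> list_all2 E x y}"
    by (rule ramsey_subset)
  then show ?case by simp
qed

abbreviation hales_jewett :: "nat \<Rightarrow> bool" where
  "hales_jewett k \<equiv> ramsey k k 1 (words k 1 \<times> words k 1)"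

lemma words_1_Times: "words k (Suc 0) \<times> words k (Suc 0) = {([a], [b]) | a b. a < k \<and> b < k}"
  by (auto simp: words_1_iff)

text \<open>Shelah's pigeonhole step: among the r + 1 words that consist of copies of k followed
  by copies of k - 1, two have the same colour, and they differ by one block of letters, which
  becomes the wildcard.\<close>

lemma ramsey_swap_letters:
  "ramsey (Suc k) (Suc k) 1 {([a], [b]) | a b. (a, b) \<in> {(k, k - 1)} \<union> {(a, a) | a. a \<le> k}}"
  unfolding ramsey_def
proof
  fix r :: nat
  define w :: "nat \<Rightarrow> nat list" where "w j = replicate j k @ replicate (r - j) (k - 1)" for j
  show "\<exists>n. \<forall>c. (\<forall>x\<in>words (Suc k) n. c x < r) \<longrightarrow> (\<exists>t. template (Suc k) 1 n t \<and>
     (\<forall>(x, y)\<in>{([a], [b]) | a b. (a, b) \<in> {(k, k - 1)} \<union> {(a, a) | a. a \<le> k}}. c (inst t x) = c (inst t y)))"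
  proof (rule exI[of _ "r"], intro allI impI)
    fix c assume c: "\<forall>x\<in>words (Suc k) r. c x < r"
    have "w j \<in> words (Suc k) r" if "j \<le> r" for j
      using that by (auto simp: words_def w_def)
    then have "(c \<circ> w) ` {..r} \<subseteq> {..<r}" using c by auto
    then have "card ((c \<circ> w) ` {..r}) < card {..r}"
      by (metis card_atMost card_lessThan card_mono finite_lessThan le_imp_less_Suc)
    then have "\<not> inj_on (c \<circ> w) {..r}" using pigeonhole by blast
    then obtain i j where ij: "i < j" "j \<le> r" "c (w i) = c (w j)"
      unfolding inj_on_def by (metis atMost_iff comp_apply linorder_neqE_nat)
    define t :: "(nat + nat) list" where
      "t = replicate i (Inl k) @ replicate (j - i) (Inr 0) @ replicate (r - j) (Inl (k - 1))"
    have "template (Suc k) 1 r t" using ij by (auto simp: template_def t_def)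
    moreover have "inst t [k] = w j" "inst t [k - 1] = w i"
      using ij by (simp_all add: inst_def t_def w_def replicate_add[symmetric] flip: append_assoc)
        (simp add: replicate_add[symmetric])
    ultimately show "\<exists>t. template (Suc k) 1 r t \<and>
     (\<forall>(x, y)\<in>{([a], [b]) | a b. (a, b) \<in> {(k, k - 1)} \<union> {(a, a) | a. a \<le> k}}. c (inst t x) = c (inst t y))"
      using ij(3) by (intro exI[of _ t]) auto
  qed
qed

lemma hales_jewett_1: "hales_jewett 1"
  unfolding ramsey_def
proof
  fix r :: nat
  show "\<exists>n. \<forall>c. (\<forall>x\<in>words 1 n. c x < r) \<longrightarrow>
     (\<exists>t. template 1 1 n t \<and> (\<forall>(x, y)\<in>words 1 1 \<times> words 1 1. c (inst t x) = c (inst t y)))"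
    by (intro exI[of _ 1] allI impI exI[of _ "[Inr 0]"])
      (auto simp: template_def words_1_iff)
qed

text \<open>By \<open>ramsey_power\<close> and \<open>ramsey_swap_letters\<close> the colouring
  becomes insensitive to exchanging k and k - 1 at any coordinate. A line that is monochromatic
  for the letters below k then stays monochromatic with the letter k.\<close>

lemma hales_jewett_Suc:
  assumes "k > 0" and HJ: "hales_jewett k"
  shows "hales_jewett (Suc k)"
  unfolding ramsey_def
proof
  fix r :: nat
  let ?E = "\<lambda>a b. (a, b) \<in> {(k, k - 1)} \<union> {(a, a) | a. a \<le> k}"
  obtain m where m: "\<forall>c. (\<forall>x\<in>words k m. c x < r) \<longrightarrow>
     (\<exists>t. template k 1 m t \<and> (\<forall>(x, y)\<in>words k 1 \<times> words k 1. c (inst t x) = c (inst t y)))"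
    using ramseyD[OF HJ] by blast
  have "ramsey (Suc k) (Suc k) m {(x, y). length x = m \<and> list_all2 ?E x y}"
    by (rule ramsey_power[OF ramsey_swap_letters]) auto
  from ramseyD[OF this] obtain n where n: "\<forall>c. (\<forall>x\<in>words (Suc k) n. c x < r) \<longrightarrow>
     (\<exists>t. template (Suc k) m n t \<and> (\<forall>(x, y)\<in>{(x, y). length x = m \<and> list_all2 ?E x y}. c (inst t x) = c (inst t y)))"
    by blast
  show "\<exists>n. \<forall>c. (\<forall>x\<in>words (Suc k) n. c x < r) \<longrightarrow> (\<exists>t. template (Suc k) 1 n t \<and>
     (\<forall>(x, y)\<in>words (Suc k) 1 \<times> words (Suc k) 1. c (inst t x) = c (inst t y)))"
  proof (rule exI[of _ "n"], intro allI impI)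
    fix c assume c: "\<forall>x\<in>words (Suc k) n. c x < r"
    with n[rule_format, of c] obtain t where t: "template (Suc k) m n t"
      "\<And>x y. length x = m \<Longrightarrow> list_all2 ?E x y \<Longrightarrow> c (inst t x) = c (inst t y)" by auto
    have "c (inst t x) < r" if "x \<in> words k m" for x
      using c inst_in_words[OF t(1) order_refl, of x] words_mono[of k "Suc k" m] that by auto
    with m[rule_format, of "\<lambda>x. c (inst t x)"] obtain s where s: "template k 1 m s"
      "\<forall>(x, y)\<in>words k 1 \<times> words k 1. c (inst t (inst s x)) = c (inst t (inst s y))" by auto
    have len: "length s = m" using templateD(1)[OF s(1)] .
    have last: "c (inst t (inst s [k])) = c (inst t (inst s [k - 1]))"
    proof (rule t(2))
      show "list_all2 ?E (inst s [k]) (inst s [k - 1])"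
      proof (rule list_all2_all_nthI)
        fix i assume i: "i < length (inst s [k])"
        then have i': "i < length s" and v: "s ! i \<in> set s" by simp_all
        show "?E (inst s [k] ! i) (inst s [k - 1] ! i)"
        proof (cases "s ! i")
          case (Inl a)
          with i' v templateD(2)[OF s(1), of a] show ?thesis by (simp add: inst_def)
        next
          case (Inr j)
          with i' v templateD(3)[OF s(1), of j] show ?thesis by (simp add: inst_def)
        qed
      qed simp
    qed (simp add: len)
    define c0 where "c0 = c (inst t (inst s [k - 1]))"
    have const: "c (inst t (inst s [a])) = c0" if "a < Suc k" for a
      unfolding c0_def
    proof (cases "a = k")
      case False
      then have "([a], [k - 1]) \<in> words k 1 \<times> words k 1" using that \<open>k > 0\<close> by simp
      then show "c (inst t (inst s [a])) = c (inst t (inst s [k - 1]))" using s(2) by blast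
    qed (simp add: last)
    have "\<forall>(x, y)\<in>words (Suc k) 1 \<times> words (Suc k) 1.
        c (inst (comp_template t s) x) = c (inst (comp_template t s) y)"
      by (auto simp: words_1_iff inst_comp[OF t(1) len] const)
    moreover have "template (Suc k) 1 n (comp_template t s)"
      using template_comp[OF t(1) template_mono[OF s(1)]] by simp
    ultimately show "\<exists>t. template (Suc k) 1 n t \<and>
     (\<forall>(x, y)\<in>words (Suc k) 1 \<times> words (Suc k) 1. c (inst t x) = c (inst t y))"
      by blast
  qed
qed

theorem hales_jewett: "k > 0 \<Longrightarrow> hales_jewett k"
proof (induction k)
  case (Suc k)
  then show ?case using hales_jewett_1 hales_jewett_Suc[of k] by (cases "k = 0") auto
qed simp

lemma hales_jewett_multidim:
  assumes "k > 0"
  shows "ramsey k k m (words k m \<times> words k m)"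
proof -
  have "ramsey k k m {(x, y). length x = m \<and> list_all2 (\<lambda>a b. a < k \<and> b < k) x y}"
    by (rule ramsey_power) (use hales_jewett[OF assms] in \<open>auto simp: words_1_Times\<close>)
  then show ?thesis
    by (rule ramsey_subset) (auto simp: list_all2_conv_all_nth length_words nth_words)
qed

definition first_one :: "nat list \<Rightarrow> nat" where
  "first_one x = length (takeWhile (\<lambda>a. a \<noteq> 1) x)"

text \<open>Words over {0,1} are finite sets. Colour the sets containing the first element: the
  multidimensional Hales-Jewett theorem gives a subspace of constant colour. Its fixed letters 1
  are attached to the first coordinate, which turns them into 0 for the sets that avoid the first
  element. Those are treated by the induction hypothesis.\<close>

lemma ramsey_first_one:
  "ramsey 1 2 m {(x, y). x \<in> words 2 m \<and> y \<in> words 2 m \<and> 1 \<in> set x \<and> 1 \<in> set y \<and>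
     first_one x = first_one y}"
proof (induction m)
  case 0
  show ?case by (rule ramsey_subset[OF ramsey_0]) auto
next
  case (Suc m)
  let ?R = "\<lambda>m. {(x, y). x \<in> words 2 m \<and> y \<in> words 2 m \<and> 1 \<in> set x \<and> 1 \<in> set y \<and>
     first_one x = first_one y}"
  show ?case unfolding ramsey_def
  proof
    fix r :: nat
    obtain g where g: "\<forall>c. (\<forall>x\<in>words 2 g. c x < r) \<longrightarrow>
        (\<exists>t. template 1 m g t \<and> (\<forall>(x, y)\<in>?R m. c (inst t x) = c (inst t y)))"
      using ramseyD[OF Suc] by blast
    obtain n where n: "\<forall>c. (\<forall>x\<in>words 2 n. c x < r) \<longrightarrow>
        (\<exists>t. template 2 g n t \<and> (\<forall>(x, y)\<in>words 2 g \<times> words 2 g. c (inst t x) = c (inst t y)))"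
      using ramseyD[OF hales_jewett_multidim[of 2 g]] by fastforce
    show "\<exists>n. \<forall>c. (\<forall>x\<in>words 2 n. c x < r) \<longrightarrow>
        (\<exists>t. template 1 (Suc m) n t \<and> (\<forall>(x, y)\<in>?R (Suc m). c (inst t x) = c (inst t y)))"
    proof (rule exI[of _ "Suc n"], intro allI impI)
      fix c assume c: "\<forall>x\<in>words 2 (Suc n). c x < r"
      then have "\<forall>x\<in>words 2 n. c (1 # x) < r" by auto
      with n[rule_format, of "\<lambda>x. c (1 # x)"] obtain t1 where t1: "template 2 g n t1"
        "\<forall>(x, y)\<in>words 2 g \<times> words 2 g. c (1 # inst t1 x) = c (1 # inst t1 y)" by auto
      \<comment> \<open>The map \<phi> turns the fixed letters 1 of t1 into the new
        first coordinate.\<close>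
      define \<phi> :: "nat + nat \<Rightarrow> nat + nat" where
        "\<phi> v = (case v of Inl a \<Rightarrow> (if a = 0 then Inl 0 else Inr 0) | Inr j \<Rightarrow> Inr (Suc j))" for v
      define T where "T = Inr 0 # map \<phi> t1"
      have T: "template 1 (Suc g) (Suc n) T"
      proof -
        have "\<phi> v \<in> Inl ` {..<1} \<union> Inr ` {..<Suc g}" if "v \<in> set t1" for v
        proof (cases v)
          case (Inr j)
          then show ?thesis using templateD(3)[OF t1(1), of j] that by (simp add: \<phi>_def)
        qed (auto simp: \<phi>_def)
        moreover have "Inr j \<in> set T" if "j < Suc g" for j
        proof (cases j)
          case (Suc i)
          then have "Inr i \<in> set t1" using templateD(4)[OF t1(1)] that by simp
          then have "\<phi> (Inr i) \<in> set T" unfolding T_def by auto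
          then show ?thesis using Suc by (simp add: \<phi>_def)
        qed (simp add: T_def)
        ultimately show ?thesis
          using templateD(1)[OF t1(1)] unfolding template_def by (auto simp: T_def)
      qed
      have T1: "inst T (1 # x) = 1 # inst t1 x" for x
      proof -
        have "case_sum id ((!) (1 # x)) (\<phi> v) = case_sum id ((!) x) v" if "v \<in> set t1" for v
        proof (cases v)
          case (Inl a)
          then show ?thesis using templateD(2)[OF t1(1), of a] that by (auto simp: \<phi>_def)
        qed (simp add: \<phi>_def)
        then show ?thesis by (simp add: T_def inst_def del: One_nat_def)
      qed
      have "c (inst T (0 # x)) < r" if "x \<in> words 2 g" for x
        using c inst_in_words[OF T, of 2 "0 # x"] that by auto
      with g[rule_format, of "\<lambda>x. c (inst T (0 # x))"] obtain t2 where t2: "template 1 m g t2"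
        "\<forall>(x, y)\<in>?R m. c (inst T (0 # inst t2 x)) = c (inst T (0 # inst t2 y))" by auto
      define s where "s = comp_template T (Inr 0 # shift_vars (Suc 0) t2)"
      have s: "template 1 (Suc m) (Suc n) s"
        unfolding s_def by (rule template_comp[OF T template_new_var[OF t2(1)]])
      have "length (shift_vars (Suc 0) t2) = g"
        using templateD(1)[OF t2(1)] by (simp add: shift_vars_def)
      then have inst_s: "inst s (a # x) = inst T (a # inst t2 x)" for a x
        unfolding s_def by (subst inst_comp[OF T]) simp_all
      have "c (inst s x) = c (inst s y)" if xy: "(x, y) \<in> ?R (Suc m)" for x y
      proof -
        obtain a x' where x: "x = a # x'" "a < 2" "x' \<in> words 2 m"
          using xy by (auto elim: words_SucE)
        obtain b y' where y: "y = b # y'" "b < 2" "y' \<in> words 2 m"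
          using xy by (auto elim: words_SucE)
        have w: "inst t2 x' \<in> words 2 g" "inst t2 y' \<in> words 2 g"
          using inst_in_words[OF t2(1)] x y by simp_all
        have ab: "(a = 1) = (b = 1)"
          using xy unfolding x(1) y(1) by (auto simp: first_one_def split: if_splits)
        show ?thesis
        proof (cases "a = 1")
          case True
          with ab have "a = 1" "b = 1" by simp_all
          moreover have "c (1 # inst t1 (inst t2 x')) = c (1 # inst t1 (inst t2 y'))"
            using t1(2) w by blast
          ultimately show ?thesis by (simp only: x(1) y(1) inst_s T1)
        next
          case False
          then have "a = 0" "b = 0" using ab x y by auto
          moreover have "(x', y') \<in> ?R m"
            using xy x y calculation by (auto simp: first_one_def)
          ultimately show ?thesis using t2(2) by (auto simp: x(1) y(1) inst_s)
        qed
      qed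
      with s show "\<exists>t. template 1 (Suc m) (Suc n) t \<and> (\<forall>(x, y)\<in>?R (Suc m). c (inst t x) = c (inst t y))"
        by blast
    qed
  qed
qed

lemma large_fibre:
  assumes "g \<in> {..<r * m + 1} \<rightarrow> {..<r::nat}"
  obtains a where "m \<le> card {i. i < r * m + 1 \<and> g i = a}"
proof (rule ccontr)
  assume "\<not> thesis"
  with that have *: "card {i. i < r * m + 1 \<and> g i = a} \<le> m" for a by (meson linear)
  have "{..<r * m + 1} = (\<Union>a\<in>{..<r}. {i. i < r * m + 1 \<and> g i = a})" using assms by auto
  then have "card {..<r * m + 1} \<le> (\<Sum>a<r. card {i. i < r * m + 1 \<and> g i = a})"
    using card_UN_le[of "{..<r}" "\<lambda>a. {i. i < r * m + 1 \<and> g i = a}"] by simp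
  also have "\<dots> \<le> (\<Sum>a<r. m)" by (intro sum_mono *)
  finally show False by simp
qed

lemma template_select:
  assumes "I \<subseteq> {..<n}" "card I = m"
  obtains t where "template 1 m n t" "\<And>x i. i < n \<Longrightarrow> i \<notin> I \<Longrightarrow> inst t x ! i = 0"
proof -
  have "finite I" using assms(1) finite_subset by blast
  then obtain e where e: "bij_betw e I {..<m}"
    using ex_bij_betw_finite_nat[of I] assms(2) atLeast0LessThan by metis
  define t :: "(nat + nat) list" where "t = map (\<lambda>i. if i \<in> I then Inr (e i) else Inl 0) [0..<n]"
  show thesis
  proof
    have "Inr j \<in> set t" if "j < m" for j
    proof -
      have "j \<in> e ` I" using e that by (simp add: bij_betw_def)
      then obtain i where "i \<in> I" "e i = j" by blast
      then show ?thesis using assms(1) by (force simp: t_def)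
    qed
    moreover have "set t \<subseteq> Inl ` {..<1} \<union> Inr ` {..<m}"
      using bij_betwE[OF e] by (auto simp: t_def)
    ultimately show "template 1 m n t" by (auto simp: template_def t_def)
  qed (simp add: t_def inst_def)
qed

text \<open>Folkman's finite unions theorem. Once the colour depends only on the first element,
  the pigeonhole principle selects m coordinates with the same colour; the other coordinates are
  set to 0, so that the first element of a nonempty set lies among the selected ones.\<close>

lemma finite_unions:
  "ramsey 1 2 m {(x, y). x \<in> words 2 m \<and> y \<in> words 2 m \<and> 1 \<in> set x \<and> 1 \<in> set y}"
  unfolding ramsey_def
proof
  fix r :: nat
  define M where "M = r * m + 1"
  obtain n where n: "\<forall>c. (\<forall>x\<in>words 2 n. c x < r) \<longrightarrow> (\<exists>t. template 1 M n t \<and>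
      (\<forall>(x, y)\<in>{(x, y). x \<in> words 2 M \<and> y \<in> words 2 M \<and> 1 \<in> set x \<and> 1 \<in> set y \<and>
     first_one x = first_one y}. c (inst t x) = c (inst t y)))"
    using ramseyD[OF ramsey_first_one[of M]] by blast
  show "\<exists>n. \<forall>c. (\<forall>x\<in>words 2 n. c x < r) \<longrightarrow> (\<exists>t. template 1 m n t \<and>
      (\<forall>(x, y)\<in>{(x, y). x \<in> words 2 m \<and> y \<in> words 2 m \<and> 1 \<in> set x \<and> 1 \<in> set y}.
        c (inst t x) = c (inst t y)))"
  proof (rule exI[of _ n], intro allI impI)
    fix c assume c: "\<forall>x\<in>words 2 n. c x < r"
    with n obtain t where t: "template 1 M n t"
      "\<And>x y. x \<in> words 2 M \<Longrightarrow> y \<in> words 2 M \<Longrightarrow> 1 \<in> set x \<Longrightarrow> 1 \<in> set y \<Longrightarrow>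
        first_one x = first_one y \<Longrightarrow> c (inst t x) = c (inst t y)" by blast
    define unit :: "nat \<Rightarrow> nat list" where "unit i = replicate i 0 @ 1 # replicate (M - Suc i) 0" for i
    define g where "g i = c (inst t (unit i))" for i
    have unit: "unit i \<in> words 2 M" "1 \<in> set (unit i)" "first_one (unit i) = i" if "i < M" for i
      using that by (auto simp: unit_def words_def first_one_def takeWhile_append)
    have first: "first_one x < M" "x ! first_one x = 1" if "x \<in> words 2 M" "1 \<in> set x" for x
    proof -
      have "length (takeWhile (\<lambda>a. a \<noteq> 1) x) < length x"
        using that(2) takeWhile_eq_take[of "\<lambda>a. a \<noteq> 1" x] takeWhile_eq_all_conv[of "\<lambda>a. a \<noteq> 1" x]
        by (metis not_le take_all)
      then show "first_one x < M" "x ! first_one x = 1"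
        using that(1) nth_length_takeWhile[of "\<lambda>a. a \<noteq> 1" x] by (auto simp: first_one_def words_def)
    qed
    have g: "c (inst t x) = g (first_one x)" if "x \<in> words 2 M" "1 \<in> set x" for x
      unfolding g_def by (rule t(2)) (use that unit[of "first_one x"] first in auto)
    have "g \<in> {..<r * m + 1} \<rightarrow> {..<r}"
      using c inst_in_words[OF t(1), of 2] unit(1) unfolding g_def M_def[symmetric] by auto
    then obtain a where "m \<le> card {i. i < M \<and> g i = a}"
      unfolding M_def by (rule large_fibre)
    then obtain I where I: "I \<subseteq> {i. i < M \<and> g i = a}" "card I = m"
      using obtain_subset_with_card_n by blast
    obtain s where s: "template 1 m M s" "\<And>x i. i < M \<Longrightarrow> i \<notin> I \<Longrightarrow> inst s x ! i = 0"
      using template_select[of I M m] I by blast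
    have col: "c (inst (comp_template t s) x) = a" if "x \<in> words 2 m" "1 \<in> set x" for x
    proof -
      let ?z = "inst s x"
      have z: "?z \<in> words 2 M" "1 \<in> set ?z"
        using inst_in_words[OF s(1) _ that(1)] subsetD[OF var_value_in_inst[OF s(1) length_words[OF that(1)]] that(2)]
        by simp_all
      then have "first_one ?z \<in> I" using s(2) first[OF z] by (metis zero_neq_one)
      then show ?thesis
        using g[OF z] I(1) inst_comp[OF t(1)] templateD(1)[OF s(1)] by auto
    qed
    moreover have "template 1 m n (comp_template t s)" by (rule template_comp[OF t(1) s(1)])
    ultimately show "\<exists>t. template 1 m n t \<and>
      (\<forall>(x, y)\<in>{(x, y). x \<in> words 2 m \<and> y \<in> words 2 m \<and> 1 \<in> set x \<and> 1 \<in> set y}.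
        c (inst t x) = c (inst t y))"
      by (intro exI[of _ "comp_template t s"]) auto
  qed
qed

text \<open>The Hales-Jewett theorem on each of n blocks makes the colour independent of all
  letters other than k, so that only the positions of k matter.\<close>

lemma ramsey_same_support:
  assumes "k > 0"
  shows "ramsey k (Suc k) n
    {(x, y). length x = n \<and> list_all2 (\<lambda>a b. a < k \<and> b < k \<or> a = k \<and> b = k) x y}"
proof (rule ramsey_power)
  show "ramsey k (Suc k) 1 {([a], [b]) |a b. a < k \<and> b < k \<or> a = k \<and> b = k}"
    unfolding ramsey_def
  proof
    fix r :: nat
    obtain n where n: "\<forall>c. (\<forall>x\<in>words k n. c x < r) \<longrightarrow>
        (\<exists>t. template k 1 n t \<and> (\<forall>(x, y)\<in>words k 1 \<times> words k 1. c (inst t x) = c (inst t y)))"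
      using ramseyD[OF hales_jewett[OF assms]] by blast
    show "\<exists>n. \<forall>c. (\<forall>x\<in>words (Suc k) n. c x < r) \<longrightarrow> (\<exists>t. template k 1 n t \<and>
        (\<forall>(x, y)\<in>{([a], [b]) |a b. a < k \<and> b < k \<or> a = k \<and> b = k}. c (inst t x) = c (inst t y)))"
    proof (rule exI[of _ n], intro allI impI)
      fix c assume "\<forall>x\<in>words (Suc k) n. c x < r"
      then have "\<forall>x\<in>words k n. c x < r" using words_mono[of k "Suc k" n] by auto
      then obtain t where t: "template k 1 n t"
        "\<forall>(x, y)\<in>words k 1 \<times> words k 1. c (inst t x) = c (inst t y)"
        using n by blast
      have "\<forall>(x, y)\<in>{([a], [b]) |a b. a < k \<and> b < k \<or> a = k \<and> b = k}. c (inst t x) = c (inst t y)"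
        using t(2) by (auto simp: words_1_Times)
      with t(1) show "\<exists>t. template k 1 n t \<and>
        (\<forall>(x, y)\<in>{([a], [b]) |a b. a < k \<and> b < k \<or> a = k \<and> b = k}. c (inst t x) = c (inst t y))"
        by blast
    qed
  qed
qed auto

text \<open>After \<open>ramsey_same_support\<close> only the set of occurrences of the variable k
  matters, and the claim becomes the finite unions theorem.\<close>

theorem graham_rothschild:
  assumes "k > 0"
  shows "ramsey k (Suc k) m
    {(x, y). x \<in> words (Suc k) m \<and> y \<in> words (Suc k) m \<and> k \<in> set x \<and> k \<in> set y}"
  unfolding ramsey_def
proof
  fix r :: nat
  let ?E = "\<lambda>a b. a < k \<and> b < k \<or> a = k \<and> b = k"
  obtain n where n: "\<forall>c. (\<forall>x\<in>words 2 n. c x < r) \<longrightarrow> (\<exists>t. template 1 m n t \<and>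
      (\<forall>(x, y)\<in>{(x, y). x \<in> words 2 m \<and> y \<in> words 2 m \<and> 1 \<in> set x \<and> 1 \<in> set y}.
        c (inst t x) = c (inst t y)))"
    using ramseyD[OF finite_unions[of m]] by blast
  obtain N where N: "\<forall>c. (\<forall>x\<in>words (Suc k) N. c x < r) \<longrightarrow> (\<exists>t. template k n N t \<and>
      (\<forall>(x, y)\<in>{(x, y). length x = n \<and> list_all2 ?E x y}. c (inst t x) = c (inst t y)))"
    using ramseyD[OF ramsey_same_support[OF assms, of n]] by blast
  show "\<exists>n. \<forall>c. (\<forall>x\<in>words (Suc k) n. c x < r) \<longrightarrow> (\<exists>t. template k m n t \<and>
    (\<forall>(x, y)\<in>{(x, y). x \<in> words (Suc k) m \<and> y \<in> words (Suc k) m \<and> k \<in> set x \<and> k \<in> set y}.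
      c (inst t x) = c (inst t y)))"
  proof (rule exI[of _ N], intro allI impI)
    fix c assume c: "\<forall>x\<in>words (Suc k) N. c x < r"
    with N obtain t1 where t1: "template k n N t1"
      "\<And>x y. length x = n \<Longrightarrow> list_all2 ?E x y \<Longrightarrow> c (inst t1 x) = c (inst t1 y)" by blast
    define dec :: "nat list \<Rightarrow> nat list" where "dec = map (\<lambda>b. if b = 1 then k else 0)"
    define enc :: "nat list \<Rightarrow> nat list" where "enc = map (\<lambda>a. of_bool (a = k))"
    have "c (inst t1 (dec z)) < r" if "z \<in> words 2 n" for z
    proof -
      have "dec z \<in> words (Suc k) n" using that by (auto simp: dec_def words_def)
      then show ?thesis using c inst_in_words[OF t1(1), of "Suc k"] by simp
    qed
    with n[rule_format, of "\<lambda>z. c (inst t1 (dec z))"] obtain t2 where t2: "template 1 m n t2"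
      "\<And>x y. x \<in> words 2 m \<Longrightarrow> y \<in> words 2 m \<Longrightarrow> 1 \<in> set x \<Longrightarrow> 1 \<in> set y \<Longrightarrow>
        c (inst t1 (dec (inst t2 x))) = c (inst t1 (dec (inst t2 y)))" by blast
    have len: "length t2 = n" using templateD(1)[OF t2(1)] .
    have dec_enc: "c (inst t1 (inst t2 x)) = c (inst t1 (dec (inst t2 (enc x))))"
      if "x \<in> words (Suc k) m" for x
    proof (rule t1(2))
      show "list_all2 ?E (inst t2 x) (dec (inst t2 (enc x)))"
      proof (rule list_all2_all_nthI)
        fix i assume "i < length (inst t2 x)"
        then have i: "i < length t2" and v: "t2 ! i \<in> set t2" by simp_all
        show "?E (inst t2 x ! i) (dec (inst t2 (enc x)) ! i)"
        proof (cases "t2 ! i")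
          case (Inl a)
          with i v templateD(2)[OF t2(1), of a] \<open>k > 0\<close> show ?thesis by (simp add: inst_def dec_def)
        next
          case (Inr j)
          with v templateD(3)[OF t2(1), of j] have "j < m" by simp
          with i Inr nth_words[OF that, of j] length_words[OF that] \<open>k > 0\<close>
          show ?thesis by (auto simp: inst_def dec_def enc_def)
        qed
      qed (simp add: dec_def)
    qed (simp add: len)
    have enc: "enc x \<in> words 2 m" "1 \<in> set (enc x)" if "x \<in> words (Suc k) m" "k \<in> set x" for x
      using that by (auto simp: enc_def words_def image_iff)
    have "c (inst (comp_template t1 t2) x) = c (inst (comp_template t1 t2) y)"
      if "x \<in> words (Suc k) m" "y \<in> words (Suc k) m" "k \<in> set x" "k \<in> set y" for x y
      using dec_enc t2(2) enc that by (simp add: inst_comp[OF t1(1) len])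
    moreover have "template k m N (comp_template t1 t2)"
      using template_comp[OF t1(1) template_mono[OF t2(1)]] \<open>k > 0\<close> by simp
    ultimately show "\<exists>t. template k m N t \<and>
      (\<forall>(x, y)\<in>{(x, y). x \<in> words (Suc k) m \<and> y \<in> words (Suc k) m \<and> k \<in> set x \<and> k \<in> set y}.
        c (inst t x) = c (inst t y))"
      by (intro exI[of _ "comp_template t1 t2"]) auto
  qed
qed

section \<open>Density Hales-Jewett: insensitive sets\<close>

definition line_free :: "nat \<Rightarrow> nat \<Rightarrow> nat list set \<Rightarrow> bool" where
  "line_free k n A \<longleftrightarrow> \<not> (\<exists>t. template k 1 n t \<and> (\<forall>a<k. inst t [a] \<in> A))"

definition density_hales_jewett :: "nat \<Rightarrow> bool" where
  "density_hales_jewett k \<longleftrightarrow> (\<forall>\<delta>>0. \<exists>n0. \<forall>n\<ge>n0. \<forall>A. line_free k n A \<longrightarrow> mean k n (indicat_real A) < \<delta>)"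

lemma density_hales_jewett_1: "density_hales_jewett 1"
  unfolding density_hales_jewett_def
proof (intro allI impI exI[of _ 1])
  fix \<delta> :: real and n A assume "\<delta> > 0" "1 \<le> n" "line_free 1 n A"
  have "template 1 1 n (replicate n (Inr 0))" using \<open>1 \<le> n\<close> by (auto simp: template_def)
  then have "inst (replicate n (Inr 0)) [0] \<notin> A"
    using \<open>line_free 1 n A\<close> unfolding line_free_def by (metis less_one)
  moreover have "x = inst (replicate n (Inr 0)) [0]" if "x \<in> words 1 n" for x
    using that by (auto simp: words_def inst_def intro!: replicate_eqI)
  ultimately have "mean 1 n (indicat_real A) = mean 1 n (\<lambda>_. 0)"
    by (intro mean_cong) (metis indicator_simps(2))
  then show "mean 1 n (indicat_real A) < \<delta>" using \<open>\<delta> > 0\<close> by simp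
qed

text \<open>For many tails y the fibre above y is dense and contains an m-dimensional subspace,
  and there are only finitely many such subspaces, so one of them occurs above a dense set of y;
  this set contains a line, which supplies the last coordinate.\<close>

lemma multidim_density_hales_jewett:
  assumes dhj: "density_hales_jewett k" and k: "k > 0" and "\<delta> > 0"
  shows "\<exists>n0. \<forall>n\<ge>n0. \<forall>A. \<delta> \<le> mean k n (indicat_real A) \<longrightarrow>
    (\<exists>t. template k m n t \<and> (\<forall>x\<in>words k m. inst t x \<in> A))"
  using \<open>\<delta> > 0\<close>
proof (induction m arbitrary: \<delta>)
  case 0
  have "\<exists>t. template k 0 n t \<and> (\<forall>x\<in>words k 0. inst t x \<in> A)"
    if "\<delta> \<le> mean k n (indicat_real A)" for n A
  proof -
    have "mean k n (indicat_real A) > 0" using that \<open>\<delta> > 0\<close> by linarith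
    from mean_gtE[OF k this] obtain w where "w \<in> words k n" "indicat_real A w > 0" by blast
    then show ?thesis
      using template_const[of w k n] by (intro exI[of _ "map Inl w"]) (simp add: indicator_def split: if_splits)
  qed
  then show ?case by blast
next
  case (Suc m)
  then obtain n1 where n1: "\<And>n A. n \<ge> n1 \<Longrightarrow> \<delta> / 2 \<le> mean k n (indicat_real A) \<Longrightarrow>
    \<exists>t. template k m n t \<and> (\<forall>x\<in>words k m. inst t x \<in> A)"
    by (metis half_gt_zero)
  define T where "T = {t. template k m n1 t}"
  \<comment> \<open>Small enough that the sets B t, if each had density at most
    \<eta>, could not have total density \<open>\<delta>/2\<close>.\<close>
  define \<eta> where "\<eta> = \<delta> / (2 * (real (card T) + 1))"
  have "\<eta> > 0" using Suc.prems by (simp add: \<eta>_def)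
  then obtain n2 where n2: "\<And>n A. n \<ge> n2 \<Longrightarrow> line_free k n A \<Longrightarrow> mean k n (indicat_real A) < \<eta>"
    using dhj unfolding density_hales_jewett_def by blast
  show ?case
  proof (rule exI[of _ "n1 + n2"], intro allI impI)
    fix N A assume "n1 + n2 \<le> N" and A: "\<delta> \<le> mean k N (indicat_real A)"
    then obtain n where N: "N = n1 + n" and "n2 \<le> n" by (metis add_le_cancel_left le_add1 le_iff_add le_trans)
    define B where "B t = {y. \<forall>x\<in>words k m. inst t x @ y \<in> A}" for t
    have "mean k n1 (\<lambda>x. indicat_real A (x @ y)) \<le> \<delta> / 2 + (\<Sum>t\<in>T. indicat_real (B t) y)" for y
    proof (cases "\<delta> / 2 \<le> mean k n1 (indicat_real {x. x @ y \<in> A})")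
      case True
      then obtain t where "t \<in> T" "y \<in> B t"
        using n1[of n1 "{x. x @ y \<in> A}"] by (auto simp: T_def B_def)
      then have "1 \<le> (\<Sum>t\<in>T. indicat_real (B t) y)"
        using member_le_sum[of t T "\<lambda>t. indicat_real (B t) y"] by (simp add: T_def)
      moreover have "mean k n1 (\<lambda>x. indicat_real A (x @ y)) \<le> 1"
        by (rule mean_le_const[OF k]) (simp add: indicator_def)
      ultimately show ?thesis using Suc.prems by linarith
    next
      case False
      moreover have "(\<lambda>x. indicat_real A (x @ y)) = indicat_real {x. x @ y \<in> A}"
        by (auto simp: indicator_def)
      moreover have "0 \<le> (\<Sum>t\<in>T. indicat_real (B t) y)" by (simp add: sum_nonneg)
      ultimately show ?thesis by simp
    qed
    then have "mean k n (\<lambda>y. mean k n1 (\<lambda>x. indicat_real A (x @ y)))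
        \<le> mean k n (\<lambda>y. \<delta> / 2 + (\<Sum>t\<in>T. indicat_real (B t) y))"
      by (intro mean_mono) simp
    also have "\<dots> = \<delta> / 2 + (\<Sum>t\<in>T. mean k n (indicat_real (B t)))"
      by (simp add: mean_add mean_sum k)
    finally have *: "\<delta> / 2 \<le> (\<Sum>t\<in>T. mean k n (indicat_real (B t)))"
      using A by (simp add: N mean_append mean_swap[of k n])
    have "\<exists>t\<in>T. \<eta> \<le> mean k n (indicat_real (B t))"
    proof (rule ccontr)
      assume "\<not> ?thesis"
      then have "(\<Sum>t\<in>T. mean k n (indicat_real (B t))) \<le> (\<Sum>t\<in>T. \<eta>)"
        by (intro sum_mono) (meson linear not_less)
      also have "\<dots> < \<delta> / 2" using Suc.prems by (simp add: \<eta>_def field_simps)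
      finally show False using * by simp
    qed
    then obtain t where t: "template k m n1 t" "\<not> line_free k n (B t)"
      using n2[OF \<open>n2 \<le> n\<close>] by (auto simp: T_def not_le[symmetric])
    then obtain s where s: "template k 1 n s" "\<And>a. a < k \<Longrightarrow> inst s [a] \<in> B t"
      unfolding line_free_def by blast
    have "inst (t @ shift_vars m s) z \<in> A" if z: "z \<in> words k (m + 1)" for z
    proof -
      obtain x y where "z = x @ y" "x \<in> words k m" "y \<in> words k 1"
        by (rule words_splitE[OF z])
      then obtain a where z: "z = x @ [a]" "x \<in> words k m" "a < k"
        by (auto simp: words_1_iff)
      then show ?thesis
        using s(2)[of a] inst_prod[OF t(1), of x s "[a]"] by (simp add: B_def length_words)
    qed
    moreover have "template k (m + 1) (n1 + n) (t @ shift_vars m s)" by (rule template_prod[OF t(1) s(1)])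
    ultimately show "\<exists>t. template k (Suc m) N t \<and> (\<forall>x\<in>words k (Suc m). inst t x \<in> A)"
      unfolding N by (metis Suc_eq_plus1)
  qed
qed

definition merge :: "nat \<Rightarrow> nat \<Rightarrow> nat list \<Rightarrow> nat list" where
  "merge k i = map (\<lambda>a. if a = k then i else a)"

lemma merge_in_words: "i < k \<Longrightarrow> x \<in> words (Suc k) n \<Longrightarrow> merge k i x \<in> words k n"
  by (force simp: merge_def words_def less_Suc_eq)

lemma merge_idem [simp]: "i < k \<Longrightarrow> merge k i (merge k i x) = merge k i x"
  by (simp add: merge_def)

lemma merge_append: "merge k i (x @ y) = merge k i x @ merge k i y"
  by (simp add: merge_def)

lemma merge_inst:
  assumes "template k' m n t" "length x = m"
  shows "merge k i (inst t (merge k i x)) = merge k i (inst t x)"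
  unfolding merge_def inst_def map_map
proof (rule map_cong[OF refl])
  fix v assume v: "v \<in> set t"
  show "((\<lambda>a. if a = k then i else a) \<circ> case_sum id ((!) (map (\<lambda>a. if a = k then i else a) x))) v
    = ((\<lambda>a. if a = k then i else a) \<circ> case_sum id ((!) x)) v"
  proof (cases v)
    case (Inr j)
    with v templateD(3)[OF assms(1), of j] assms(2) show ?thesis by simp
  qed simp
qed

lemma inst_merge:
  assumes "template k m n t" "length x = m"
  shows "inst t (merge k i x) = merge k i (inst t x)"
  unfolding merge_def inst_def map_map
proof (rule map_cong[OF refl])
  fix v assume v: "v \<in> set t"
  show "case_sum id ((!) (map (\<lambda>a. if a = k then i else a) x)) v
    = ((\<lambda>a. if a = k then i else a) \<circ> case_sum id ((!) x)) v"
  proof (cases v)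
    case (Inl a)
    with v templateD(2)[OF assms(1), of a] show ?thesis by simp
  next
    case (Inr j)
    with v templateD(3)[OF assms(1), of j] assms(2) show ?thesis by simp
  qed
qed

text \<open>Membership does not change when letters k and i are exchanged, here expressed by
  comparing each word with its representative without k.\<close>

definition insensitive :: "nat \<Rightarrow> nat \<Rightarrow> nat \<Rightarrow> nat list set \<Rightarrow> bool" where
  "insensitive k i n D \<longleftrightarrow> (\<forall>x\<in>words (Suc k) n. x \<in> D \<longleftrightarrow> merge k i x \<in> D)"

lemma insensitive_iff:
  assumes "insensitive k i n D" "x \<in> words (Suc k) n" "y \<in> words (Suc k) n" "merge k i x = merge k i y"
  shows "x \<in> D \<longleftrightarrow> y \<in> D"
  using assms unfolding insensitive_def by metis

lemma insensitiveI:
  assumes "i < k" "\<And>x y. x \<in> words (Suc k) n \<Longrightarrow> y \<in> words (Suc k) n \<Longrightarrow> merge k i x = merge k i y \<Longrightarrow> x \<in> D \<longleftrightarrow> y \<in> D"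
  shows "insensitive k i n D"
  unfolding insensitive_def
proof
  fix x assume x: "x \<in> words (Suc k) n"
  then have "merge k i x \<in> words (Suc k) n"
    using merge_in_words[OF assms(1)] words_mono[of k "Suc k" n] by auto
  from assms(2)[OF x this] show "x \<in> D \<longleftrightarrow> merge k i x \<in> D" using assms(1) by simp
qed

lemma insensitive_pullback:
  assumes "i < k" "insensitive k i n D" "template (Suc k) m n t"
  shows "insensitive k i m {x. inst t x \<in> D}"
proof (rule insensitiveI[OF assms(1)])
  fix x y assume x: "x \<in> words (Suc k) m" and y: "y \<in> words (Suc k) m" and "merge k i x = merge k i y"
  then have "merge k i (inst t x) = merge k i (inst t y)"
    using merge_inst[OF assms(3), of x k i] merge_inst[OF assms(3), of y k i] by (simp add: length_words)
  then show "x \<in> {x. inst t x \<in> D} \<longleftrightarrow> y \<in> {x. inst t x \<in> D}"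
    using insensitive_iff[OF assms(2)] inst_in_words[OF assms(3)] x y by simp
qed

text \<open>Fixing the positions of the letter k partitions the words over k + 1 letters into
  subspaces with full alphabets {0,...,k-1} in the remaining positions. Unless f has mean above
  \<beta> on one of these with dimension at least m, its mean exceeds
  \<beta> by at most the probability that a random word has fewer than m letters
  other than k. The error term e(m,n) = (2^m - 1) (3/4)^n is a crude bound for this probability.
  For the induction it need only be nonnegative, at least 1 for n = 0 and m \<ge> 1, and satisfy k
  e(m-1,n) + e(m,n) \<le> (k + 1) e(m,n+1) for m \<ge> 1, and it does so because k \<ge>
  1.\<close>

lemma mean_restrict_letters:
  assumes "k > 0" "\<And>x. x \<in> words (Suc k) n \<Longrightarrow> f x \<le> 1" "\<beta> \<ge> 0"
    and "\<And>r t. r \<ge> m \<Longrightarrow> template (Suc k) r n t \<Longrightarrow> mean k r (\<lambda>x. f (inst t x)) \<le> \<beta>"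
  shows "mean (Suc k) n f \<le> \<beta> + (2 ^ m - 1) * (3 / 4) ^ n"
  using assms(2,4)
proof (induction n arbitrary: f m)
  case 0
  show ?case
  proof (cases m)
    case 0
    have "template (Suc k) 0 0 []" by (simp add: template_def)
    from "0.prems"(2)[OF _ this] show ?thesis by (simp add: 0)
  next
    case (Suc m')
    have "(1::real) \<le> 2 ^ m - 1" by (simp add: Suc)
    moreover have "f [] \<le> 1" using "0.prems"(1) by simp
    ultimately have "f [] \<le> \<beta> + (2 ^ m - 1)" using assms(3) by linarith
    then show ?thesis by simp
  qed
next
  case (Suc n)
  have alg: "(real k * (\<beta> + u * \<rho>) + (\<beta> + v * \<rho>)) / real (Suc k)
      = \<beta> + (real k * u + v) / real (Suc k) * \<rho>" for u v \<rho> :: real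
    by (simp add: field_simps)
  \<comment> \<open>The first letter is either below k, which adds a dimension, or equal to
    k.\<close>
  define g where "g x = (\<Sum>a<k. f (a # x)) / real k" for x
  have "mean (Suc k) n g \<le> \<beta> + (2 ^ (m - 1) - 1) * (3 / 4) ^ n"
  proof (rule Suc.IH)
    fix x assume "x \<in> words (Suc k) n"
    then have "(\<Sum>a<k. f (a # x)) \<le> (\<Sum>a<k. 1)" by (intro sum_mono Suc.prems) auto
    then show "g x \<le> 1" using assms(1) by (simp add: g_def)
  next
    fix r t assume r: "r \<ge> m - 1" and t: "template (Suc k) r n t"
    have "mean k (Suc r) (\<lambda>x. f (inst (Inr 0 # shift_vars (Suc 0) t) x)) \<le> \<beta>"
      using r by (intro Suc.prems template_new_var[OF t]) auto
    then show "mean k r (\<lambda>x. g (inst t x)) \<le> \<beta>"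
      by (simp add: mean_Suc g_def mean_sum[symmetric])
        (simp add: mean_def sum_divide_distrib[symmetric] divide_divide_eq_left mult.commute)
  qed
  moreover have "mean (Suc k) n (\<lambda>x. f (k # x)) \<le> \<beta> + (2 ^ m - 1) * (3 / 4) ^ n"
  proof (rule Suc.IH)
    fix x assume "x \<in> words (Suc k) n"
    then show "f (k # x) \<le> 1" by (intro Suc.prems) auto
  next
    fix r t assume r: "r \<ge> m" and t: "template (Suc k) r n t"
    have "template (Suc k) r (1 + n) (map Inl [k] @ t)"
      by (rule template_prepend_const[OF t]) (simp add: words_def)
    then show "mean k r (\<lambda>x. f (k # inst t x)) \<le> \<beta>"
      using Suc.prems(2)[OF r, of "map Inl [k] @ t"] inst_append_const(2)[of "[k]" t] by simp
  qed
  moreover have "mean (Suc k) (Suc n) f = (real k * mean (Suc k) n g + mean (Suc k) n (\<lambda>x. f (k # x))) / real (Suc k)"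
  proof -
    have "real k * mean (Suc k) n g = (\<Sum>a<k. mean (Suc k) n (\<lambda>x. f (a # x)))"
      unfolding mean_cmult[symmetric] mean_sum[symmetric] g_def using assms(1) by simp
    then show ?thesis unfolding mean_Suc by simp
  qed
  ultimately have "mean (Suc k) (Suc n) f \<le> (real k * (\<beta> + (2 ^ (m - 1) - 1) * (3 / 4) ^ n)
      + (\<beta> + (2 ^ m - 1) * (3 / 4) ^ n)) / real (Suc k)"
    by (auto intro!: divide_right_mono add_mono mult_left_mono)
  also have "\<dots> = \<beta> + (real k * (2 ^ (m - 1) - 1) + (2 ^ m - 1)) / real (Suc k) * (3 / 4) ^ n"
    by (rule alg)
  also have "\<dots> \<le> \<beta> + (2 ^ m - 1) * (3 / 4) * (3 / 4) ^ n"
  proof -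
    have "(real k * (2 ^ (m - 1) - 1) + (2 ^ m - 1)) / real (Suc k) \<le> (2 ^ m - 1) * (3 / 4 :: real)"
    proof (cases m)
      case (Suc m')
      have "(1::real) \<le> 2 ^ m'" by simp
      moreover have "1 \<le> real k" using assms(1) by simp
      ultimately have "0 \<le> (real k - 1) * (2 ^ m' - 1)" by simp
      then show ?thesis using \<open>1 \<le> real k\<close> by (simp add: Suc field_simps)
    qed simp
    then show ?thesis by (intro add_left_mono mult_right_mono) auto
  qed
  finally show ?case by (simp only: mult.assoc power_Suc)
qed

text \<open>A dense set is dense on the words whose letters k stand in suitable fixed positions,
  and so contains a subspace for the coordinates below k by the case of k letters. Insensitivity
  allows the coordinates to take the value k as well.\<close>

lemma insensitive_contains_subspace:
  assumes dhj: "density_hales_jewett k" and i: "i < k" and "\<beta> > 0"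
  shows "\<exists>n0. \<forall>n\<ge>n0. \<forall>D. insensitive k i n D \<longrightarrow> \<beta> \<le> mean (Suc k) n (indicat_real D) \<longrightarrow>
    (\<exists>t. template (Suc k) m n t \<and> (\<forall>x\<in>words (Suc k) m. inst t x \<in> D))"
proof -
  have k: "k > 0" using i by simp
  obtain r0 where r0: "\<And>r A. r \<ge> r0 \<Longrightarrow> \<beta> / 2 \<le> mean k r (indicat_real A) \<Longrightarrow>
      \<exists>t. template k m r t \<and> (\<forall>x\<in>words k m. inst t x \<in> A)"
    using multidim_density_hales_jewett[OF dhj k, of "\<beta> / 2" m] \<open>\<beta> > 0\<close> by auto
  have "(\<lambda>n. (2 ^ r0 - 1) * (3 / 4 :: real) ^ n) \<longlonglongrightarrow> (2 ^ r0 - 1) * 0"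
    by (intro tendsto_mult tendsto_const LIMSEQ_realpow_zero) auto
  then have "\<forall>\<^sub>F n in sequentially. (2 ^ r0 - 1) * (3 / 4 :: real) ^ n < \<beta> / 2"
    by (rule order_tendstoD) (use \<open>\<beta> > 0\<close> in simp)
  then obtain n0 where n0: "\<And>n. n \<ge> n0 \<Longrightarrow> (2 ^ r0 - 1) * (3 / 4 :: real) ^ n < \<beta> / 2"
    by (auto simp: eventually_sequentially)
  show ?thesis
  proof (rule exI[of _ n0], intro allI impI)
    fix n D assume n: "n \<ge> n0" and D: "insensitive k i n D" "\<beta> \<le> mean (Suc k) n (indicat_real D)"
    have "\<exists>r t. r \<ge> r0 \<and> template (Suc k) r n t \<and> \<beta> / 2 < mean k r (\<lambda>x. indicat_real D (inst t x))"
    proof (rule ccontr)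
      assume "\<not> ?thesis"
      then have "mean (Suc k) n (indicat_real D) \<le> \<beta> / 2 + (2 ^ r0 - 1) * (3 / 4) ^ n"
        using \<open>\<beta> > 0\<close> by (intro mean_restrict_letters[OF k]) (auto simp: indicator_def not_less)
      then show False using n0[OF n] D(2) by simp
    qed
    then obtain r t where rt: "r \<ge> r0" "template (Suc k) r n t"
      "\<beta> / 2 < mean k r (\<lambda>x. indicat_real D (inst t x))" by blast
    have "(\<lambda>x. indicat_real D (inst t x)) = indicat_real {x. inst t x \<in> D}"
      by (auto simp: indicator_def)
    then obtain s where s: "template k m r s" "\<And>x. x \<in> words k m \<Longrightarrow> inst t (inst s x) \<in> D"
      using r0[OF rt(1), of "{x. inst t x \<in> D}"] rt(3) by auto
    let ?u = "comp_template t s"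
    have u: "template (Suc k) m n ?u"
      by (rule template_comp[OF rt(2) template_mono[OF s(1)]]) simp
    have inst_u: "inst ?u x = inst t (inst s x)" for x
      by (rule inst_comp[OF rt(2) templateD(1)[OF s(1)]])
    have "inst ?u x \<in> D" if x: "x \<in> words (Suc k) m" for x
    proof -
      have mx: "merge k i x \<in> words k m" by (rule merge_in_words[OF i x])
      then have "inst ?u (merge k i x) \<in> D" using s(2) by (simp add: inst_u)
      moreover have "merge k i (inst ?u (merge k i x)) = merge k i (inst ?u x)"
        by (rule merge_inst[OF u]) (simp add: length_words[OF x])
      ultimately show ?thesis
        using insensitive_iff[OF D(1)] inst_in_words[OF u order_refl] x mx words_mono[of k "Suc k" m]
        by (meson le_SucI order_refl subsetD)
    qed
    with u show "\<exists>t. template (Suc k) m n t \<and> (\<forall>x\<in>words (Suc k) m. inst t x \<in> D)" by blast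
  qed
qed

section \<open>Tiling insensitive sets by subspaces\<close>

lemma indicat_le_1: "indicat_real A x \<le> 1" "0 \<le> indicat_real A x"
  by (simp_all add: indicator_def)

text \<open>The set D is a disjoint union of m-dimensional subspaces up to density
  \<gamma>. This is stated through its effect on functions: if f
  \<le> 1 has nonpositive mean on every m-dimensional subspace, then its mean over
  D is at most \<gamma>. The form with functions makes it possible to iterate the
  result without naming the tiles. As long as D is dense, many of its sections by the last
  coordinates are dense and contain a subspace in the first n1 coordinates. These subspaces are
  removed. What remains need not be insensitive in the first n1 coordinates, but it is so in the
  others, because equivalent last coordinates have equal sections, and the same subspace is picked
  for equal sections. Each round removes a proportion \<kappa> of the
  density.\<close>

lemma tile_insensitive:
  assumes dhj: "density_hales_jewett k" and i: "i < k" and "\<gamma> > 0"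
  shows "\<exists>n0. \<forall>n\<ge>n0. \<forall>D f. insensitive k i n D \<longrightarrow> (\<forall>x\<in>words (Suc k) n. f x \<le> 1) \<longrightarrow>
    (\<forall>t. template (Suc k) m n t \<longrightarrow> mean (Suc k) m (\<lambda>x. f (inst t x)) \<le> 0) \<longrightarrow>
    mean (Suc k) n (\<lambda>x. f x * indicat_real D x) \<le> \<gamma>"
proof -
  let ?K = "Suc k"
  define \<beta> where "\<beta> = min (\<gamma> / 2) 1"
  have \<beta>: "0 < \<beta>" "\<beta> \<le> 1" "\<beta> \<le> \<gamma> / 2" using \<open>\<gamma> > 0\<close> by (auto simp: \<beta>_def)
  have "\<beta> / 2 > 0" using \<beta> by simp
  from insensitive_contains_subspace[OF dhj i this, of m]
  obtain n1 where n1: "\<And>D. insensitive k i n1 D \<Longrightarrow> \<beta> / 2 \<le> mean ?K n1 (indicat_real D) \<Longrightarrow>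
    \<exists>t. template ?K m n1 t \<and> (\<forall>x\<in>words ?K m. inst t x \<in> D)"
    by blast
  define \<kappa> where "\<kappa> = \<beta> / 2 / real (?K ^ n1)"
  have "\<kappa> \<le> \<beta> / 2 / 1"
    unfolding \<kappa>_def using \<beta> by (intro divide_left_mono) (auto simp del: of_nat_power)
  then have \<kappa>: "0 < \<kappa>" "\<kappa> \<le> 1"
    using \<beta> by (simp add: \<kappa>_def, linarith)
  \<comment> \<open>A bound that is linear in the density of D, so that it can be averaged over
    the fibres above the first n1 coordinates, although these fibres have different
    densities.\<close>
  have P: "mean ?K n (\<lambda>x. f x * indicat_real D x) \<le> \<beta> + (1 - \<kappa>) ^ s * mean ?K n (indicat_real D)"
    if "insensitive k i n D" "\<And>x. x \<in> words ?K n \<Longrightarrow> f x \<le> 1"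
      "\<And>t. template ?K m n t \<Longrightarrow> mean ?K m (\<lambda>x. f (inst t x)) \<le> 0" "s * n1 \<le> n" for s n D f
    using that
  proof (induction s arbitrary: n D f)
    case 0
    have "mean ?K n (\<lambda>x. f x * indicat_real D x) \<le> mean ?K n (indicat_real D)"
      by (intro mean_mono) (use "0.prems"(2) in \<open>auto simp: indicator_def\<close>)
    then show ?case using \<beta> by simp
  next
    case (Suc s)
    define d where "d = mean ?K n (indicat_real D)"
    have d: "0 \<le> d" "d \<le> 1"
      unfolding d_def by (auto intro!: mean_nonneg mean_le_const indicat_le_1)
    show ?case
    proof (cases "d < \<beta>")
      case True
      have "mean ?K n (\<lambda>x. f x * indicat_real D x) \<le> d" unfolding d_def
        by (intro mean_mono) (use Suc.prems(2) in \<open>auto simp: indicator_def\<close>)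
      moreover have "0 \<le> (1 - \<kappa>) ^ Suc s * d" using \<kappa> d by simp
      ultimately show ?thesis using True unfolding d_def[symmetric] by linarith
    next
      case False
      obtain n' where n: "n = n1 + n'" and n': "s * n1 \<le> n'"
        using Suc.prems(4) by (metis add_le_cancel_left le_iff_add mult_Suc add.assoc)
      define \<Phi> where "\<Phi> S t \<longleftrightarrow> template ?K m n1 t \<and> inst t ` words ?K m \<subseteq> S" for S t
      \<comment> \<open>The choice depends on the section only: this preserves insensitivity in
        the last coordinates.\<close>
      define pick where "pick S = (if \<exists>t. \<Phi> S t then inst (SOME t. \<Phi> S t) ` words ?K m else {})" for S
      have pick_cases: "pick S = {} \<and> (\<nexists>t. \<Phi> S t) \<or> (\<exists>t. \<Phi> S t \<and> pick S = inst t ` words ?K m)" for S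
        unfolding pick_def using someI_ex[of "\<Phi> S"] by auto
      have pick_sub: "pick S \<subseteq> S" for S
        using pick_cases[of S] by (auto simp: \<Phi>_def)
      define Dy where "Dy y = {x \<in> words ?K n1. x @ y \<in> D}" for y
      define D' where "D' = {z. z \<in> D \<and> take n1 z \<notin> pick (Dy (drop n1 z))}"
      have D'_iff: "x @ y \<in> D' \<longleftrightarrow> x @ y \<in> D \<and> x \<notin> pick (Dy y)" if "x \<in> words ?K n1" for x y
        using length_words[OF that] by (simp add: D'_def)
      have split: "indicat_real D (x @ y) = indicat_real (pick (Dy y)) x + indicat_real D' (x @ y)"
        if "x \<in> words ?K n1" for x y
        using D'_iff[OF that, of y] pick_sub[of "Dy y"] by (auto simp: indicator_def Dy_def)
      have merge_D: "x @ y \<in> D \<longleftrightarrow> x @ y' \<in> D"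
        if "x \<in> words ?K n1" "y \<in> words ?K n'" "y' \<in> words ?K n'" "merge k i y = merge k i y'" for x y y'
        using that by (intro insensitive_iff[OF Suc.prems(1)]) (auto simp: n append_in_words merge_append)
      have Dy_eq: "Dy y = Dy y'"
        if "y \<in> words ?K n'" "y' \<in> words ?K n'" "merge k i y = merge k i y'" for y y'
        using merge_D that by (auto simp: Dy_def)
      have "mean ?K n' (\<lambda>y. mean ?K n1 (\<lambda>x. f (x @ y) * indicat_real (pick (Dy y)) x)) \<le> 0"
      proof (rule mean_le_const)
        fix y assume y: "y \<in> words ?K n'"
        consider "pick (Dy y) = {}" | t where "template ?K m n1 t" "pick (Dy y) = inst t ` words ?K m"
          using pick_cases[of "Dy y"] by (auto simp: \<Phi>_def)
        then show "mean ?K n1 (\<lambda>x. f (x @ y) * indicat_real (pick (Dy y)) x) \<le> 0"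
        proof cases
          case 1
          then show ?thesis by simp
        next
          case 2
          have "inst t ` words ?K m \<subseteq> words ?K n1" using inst_in_words[OF 2(1)] by auto
          then have "(\<Sum>x\<in>words ?K n1. f (x @ y) * indicat_real (pick (Dy y)) x)
            = (\<Sum>x\<in>inst t ` words ?K m. f (x @ y))"
            unfolding 2(2) by (simp add: sum.inter_restrict[symmetric] Int_absorb1 indicator_def if_distrib
                cong: if_cong)
          also have "\<dots> = (\<Sum>x\<in>words ?K m. f (inst (t @ map Inl y) x))"
            by (subst sum.reindex) (auto intro!: inj_onI inst_inj[OF 2(1)] simp: length_words)
          also have "\<dots> \<le> 0"
            using Suc.prems(3)[unfolded n, OF template_append_const[OF 2(1) y]]
            by (simp add: mean_nonpos_iff)
          finally show ?thesis by (simp add: mean_nonpos_iff)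
        qed
      qed simp
      moreover have "mean ?K n1 (\<lambda>x. mean ?K n' (\<lambda>y. f (x @ y) * indicat_real D' (x @ y)))
        \<le> mean ?K n1 (\<lambda>x. \<beta> + (1 - \<kappa>) ^ s * mean ?K n' (\<lambda>y. indicat_real D' (x @ y)))"
      proof (rule mean_mono)
        fix x assume x: "x \<in> words ?K n1"
        have ind: "indicat_real D' (x @ y) = indicat_real {y. x @ y \<in> D'} y" for y
          by (simp add: indicator_def)
        show "mean ?K n' (\<lambda>y. f (x @ y) * indicat_real D' (x @ y))
          \<le> \<beta> + (1 - \<kappa>) ^ s * mean ?K n' (\<lambda>y. indicat_real D' (x @ y))"
          unfolding ind
        proof (rule Suc.IH)
          show "insensitive k i n' {y. x @ y \<in> D'}"
          proof (rule insensitiveI[OF i])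
            fix y y' assume y: "y \<in> words ?K n'" "y' \<in> words ?K n'" "merge k i y = merge k i y'"
            show "y \<in> {y. x @ y \<in> D'} \<longleftrightarrow> y' \<in> {y. x @ y \<in> D'}"
              using Dy_eq[OF y] merge_D[OF x y] by (simp add: D'_iff[OF x])
          qed
          show "f (x @ y) \<le> 1" if "y \<in> words ?K n'" for y
            using Suc.prems(2)[unfolded n, OF append_in_words[OF x that]] .
          show "mean ?K m (\<lambda>y. f (x @ inst t y)) \<le> 0" if "template ?K m n' t" for t
            using Suc.prems(3)[unfolded n, OF template_prepend_const[OF that x]] by simp
          show "s * n1 \<le> n'" by (rule n')
        qed
      qed
      moreover have "mean ?K n (\<lambda>x. f x * indicat_real D x) =
          mean ?K n' (\<lambda>y. mean ?K n1 (\<lambda>x. f (x @ y) * indicat_real (pick (Dy y)) x))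
        + mean ?K n1 (\<lambda>x. mean ?K n' (\<lambda>y. f (x @ y) * indicat_real D' (x @ y)))"
      proof -
        have "mean ?K n (\<lambda>x. f x * indicat_real D x) = mean ?K n1 (\<lambda>x. mean ?K n' (\<lambda>y.
            f (x @ y) * indicat_real (pick (Dy y)) x + f (x @ y) * indicat_real D' (x @ y)))"
          unfolding n mean_append by (intro mean_cong) (simp add: split distrib_left)
        then show ?thesis by (simp add: mean_add mean_swap[of ?K n1])
      qed
      moreover have "mean ?K n1 (\<lambda>x. mean ?K n' (\<lambda>y. indicat_real D' (x @ y))) \<le> (1 - \<kappa>) * d"
      proof -
        have "d = mean ?K n1 (\<lambda>x. mean ?K n' (\<lambda>y. indicat_real (pick (Dy y)) x + indicat_real D' (x @ y)))"
          unfolding d_def n mean_append by (intro mean_cong) (simp add: split)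
        then have d_eq: "d = mean ?K n' (\<lambda>y. mean ?K n1 (indicat_real (pick (Dy y))))
            + mean ?K n1 (\<lambda>x. mean ?K n' (\<lambda>y. indicat_real D' (x @ y)))"
          by (simp add: mean_add mean_swap[of ?K n1])
        have "1 / real (?K ^ n1) * (mean ?K n1 (\<lambda>x. indicat_real D (x @ y)) - \<beta> / 2)
            \<le> mean ?K n1 (indicat_real (pick (Dy y)))" if y: "y \<in> words ?K n'" for y
        proof (cases "\<beta> / 2 \<le> mean ?K n1 (\<lambda>x. indicat_real D (x @ y))")
          case True
          have "mean ?K n1 (\<lambda>x. indicat_real D (x @ y)) = mean ?K n1 (indicat_real {x. x @ y \<in> D})"
            by (simp add: indicator_def indicat_Collect)
          moreover have "insensitive k i n1 {x. x @ y \<in> D}"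
          proof (rule insensitiveI[OF i])
            fix x x' assume "x \<in> words ?K n1" "x' \<in> words ?K n1" "merge k i x = merge k i x'"
            then show "x \<in> {x. x @ y \<in> D} \<longleftrightarrow> x' \<in> {x. x @ y \<in> D}"
              using y insensitive_iff[OF Suc.prems(1)] by (auto simp: n append_in_words merge_append)
          qed
          ultimately have "\<exists>t. template ?K m n1 t \<and> (\<forall>x\<in>words ?K m. inst t x \<in> {x. x @ y \<in> D})"
            using n1[of "{x. x @ y \<in> D}"] True by simp
          then obtain t where "template ?K m n1 t" "\<forall>x\<in>words ?K m. inst t x @ y \<in> D" by auto
          then have "\<Phi> (Dy y) t" using inst_in_words by (auto simp: \<Phi>_def Dy_def)
          then obtain t where t: "template ?K m n1 t" "pick (Dy y) = inst t ` words ?K m"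
            using pick_cases[of "Dy y"] by (auto simp: \<Phi>_def)
          have "replicate m 0 \<in> words ?K m" by (auto simp: words_def)
          then have w: "inst t (replicate m 0) \<in> words ?K n1" "inst t (replicate m 0) \<in> pick (Dy y)"
            using t inst_in_words[OF t(1)] by auto
          have "1 / real (?K ^ n1) \<le> mean ?K n1 (indicat_real (pick (Dy y)))"
            using mean_ge_point[OF w(1), of "indicat_real (pick (Dy y))"] w(2) by simp
          moreover have "mean ?K n1 (\<lambda>x. indicat_real D (x @ y)) - \<beta> / 2 \<le> 1"
            using mean_le_const[of ?K n1 "\<lambda>x. indicat_real D (x @ y)" 1] \<beta> indicat_le_1 by fastforce
          then have "1 / real (?K ^ n1) * (mean ?K n1 (\<lambda>x. indicat_real D (x @ y)) - \<beta> / 2)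
              \<le> 1 / real (?K ^ n1) * 1"
            by (intro mult_left_mono) auto
          ultimately show ?thesis by linarith
        next
          case False
          then have "1 / real (?K ^ n1) * (mean ?K n1 (\<lambda>x. indicat_real D (x @ y)) - \<beta> / 2) \<le> 0"
            by (intro mult_nonneg_nonpos) auto
          also have "\<dots> \<le> mean ?K n1 (indicat_real (pick (Dy y)))"
            by (intro mean_nonneg indicat_le_1)
          finally show ?thesis .
        qed
        then have "mean ?K n' (\<lambda>y. 1 / real (?K ^ n1) * (mean ?K n1 (\<lambda>x. indicat_real D (x @ y)) - \<beta> / 2))
            \<le> mean ?K n' (\<lambda>y. mean ?K n1 (indicat_real (pick (Dy y))))"
          by (intro mean_mono)
        moreover have "mean ?K n' (\<lambda>y. 1 / real (?K ^ n1) * (mean ?K n1 (\<lambda>x. indicat_real D (x @ y)) - \<beta> / 2))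
            = 1 / real (?K ^ n1) * (d - \<beta> / 2)"
          unfolding mean_cmult mean_diff d_def n mean_append by (simp add: mean_swap[of ?K n1])
        moreover have "\<kappa> * d \<le> 1 / real (?K ^ n1) * (d - \<beta> / 2)"
        proof -
          have "\<kappa> * d \<le> \<kappa> * 1" using \<kappa> d by (intro mult_left_mono) auto
          also have "\<dots> = 1 / real (?K ^ n1) * (\<beta> - \<beta> / 2)" by (simp add: \<kappa>_def)
          also have "\<dots> \<le> 1 / real (?K ^ n1) * (d - \<beta> / 2)"
            using False by (intro mult_left_mono) auto
          finally show ?thesis .
        qed
        ultimately show ?thesis using d_eq by (simp add: algebra_simps)
      qed
      then have "(1 - \<kappa>) ^ s * mean ?K n1 (\<lambda>x. mean ?K n' (\<lambda>y. indicat_real D' (x @ y)))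
          \<le> (1 - \<kappa>) ^ s * ((1 - \<kappa>) * d)"
        using \<kappa> by (intro mult_left_mono) auto
      moreover have "(1 - \<kappa>) ^ s * ((1 - \<kappa>) * d) = (1 - \<kappa>) ^ Suc s * d" by simp
      ultimately show ?thesis
        unfolding d_def[symmetric] mean_add mean_cmult mean_const[OF zero_less_Suc] by linarith
    qed
  qed
  have "(\<lambda>s. (1 - \<kappa>) ^ s) \<longlonglongrightarrow> 0"
    using \<kappa> by (intro LIMSEQ_realpow_zero) auto
  then have "\<forall>\<^sub>F s in sequentially. (1 - \<kappa>) ^ s < \<gamma> / 2"
    by (rule order_tendstoD) (use \<open>\<gamma> > 0\<close> in simp)
  then obtain s where s: "(1 - \<kappa>) ^ s < \<gamma> / 2" by (auto simp: eventually_sequentially)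
  show ?thesis
  proof (rule exI[of _ "s * n1"], intro allI impI)
    fix n D f
    assume "s * n1 \<le> n" "insensitive k i n D" "\<forall>x\<in>words ?K n. f x \<le> 1"
      "\<forall>t. template ?K m n t \<longrightarrow> mean ?K m (\<lambda>x. f (inst t x)) \<le> 0"
    then have "mean ?K n (\<lambda>x. f x * indicat_real D x) \<le> \<beta> + (1 - \<kappa>) ^ s * mean ?K n (indicat_real D)"
      by (intro P) auto
    moreover have "(1 - \<kappa>) ^ s * mean ?K n (indicat_real D) \<le> (1 - \<kappa>) ^ s * 1"
      using \<kappa> by (intro mult_left_mono mean_le_const indicat_le_1) auto
    ultimately show "mean ?K n (\<lambda>x. f x * indicat_real D x) \<le> \<gamma>"
      using s \<beta> by simp
  qed
qed

text \<open>Tile one of the sets by M-dimensional subspaces with M large; in each of them the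
  other sets are insensitive again and the induction hypothesis applies. In terms of functions:
  the tiling of the last set is applied to f times the indicators of the others, lowered by
  \<open>\<gamma>/2\<close> to make its means nonpositive.\<close>

lemma tile_intersection:
  fixes r :: nat and \<iota> :: "nat \<Rightarrow> nat"
  assumes dhj: "density_hales_jewett k" and "\<forall>j<r. \<iota> j < k" and "\<gamma> > 0"
  shows "\<exists>n0. \<forall>n\<ge>n0. \<forall>D f. (\<forall>j<r. insensitive k (\<iota> j) n (D j)) \<longrightarrow> (\<forall>x\<in>words (Suc k) n. f x \<le> 1) \<longrightarrow>
    (\<forall>t. template (Suc k) m n t \<longrightarrow> mean (Suc k) m (\<lambda>x. f (inst t x)) \<le> 0) \<longrightarrow>
    mean (Suc k) n (\<lambda>x. f x * (\<Prod>j<r. indicat_real (D j) x)) \<le> \<gamma>"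
  using assms(2,3)
proof (induction r arbitrary: \<gamma>)
  case 0
  have "mean (Suc k) n f \<le> 0"
    if "m \<le> n" and f: "\<And>t. template (Suc k) m n t \<Longrightarrow> mean (Suc k) m (\<lambda>x. f (inst t x)) \<le> 0" for n f
  proof -
    obtain n' where n: "n = m + n'" using \<open>m \<le> n\<close> le_iff_add by blast
    have t: "template (Suc k) m m (map Inr [0..<m])" by (auto simp: template_def)
    have id: "inst (map Inr [0..<m]) x = x" if "x \<in> words (Suc k) m" for x
      using length_words[OF that] by (auto simp: inst_def intro!: nth_equalityI)
    have "mean (Suc k) m (\<lambda>x. f (x @ y)) \<le> 0" if "y \<in> words (Suc k) n'" for y
      using f[unfolded n, OF template_append_const[OF t that]] by (simp add: id cong: mean_cong)
    then have "mean (Suc k) n' (\<lambda>y. mean (Suc k) m (\<lambda>x. f (x @ y))) \<le> 0"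
      by (rule mean_le_const[OF zero_less_Suc])
    then show ?thesis unfolding n mean_append by (simp add: mean_swap[of _ m])
  qed
  then have "mean (Suc k) n f \<le> \<gamma>"
    if "m \<le> n" "\<forall>t. template (Suc k) m n t \<longrightarrow> mean (Suc k) m (\<lambda>x. f (inst t x)) \<le> 0" for n f
    using that "0.prems"(2) by (meson less_imp_le order_trans)
  then show ?case by (intro exI[of _ m]) (simp del: mean_const)
next
  case (Suc r)
  have "\<gamma> / 2 > 0" "\<forall>j<r. \<iota> j < k" using Suc.prems by auto
  from Suc.IH[OF this(2,1)] obtain M where M:
    "\<And>D f. (\<And>j. j < r \<Longrightarrow> insensitive k (\<iota> j) M (D j)) \<Longrightarrow> (\<And>x. x \<in> words (Suc k) M \<Longrightarrow> f x \<le> 1) \<Longrightarrow>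
    (\<And>t. template (Suc k) m M t \<Longrightarrow> mean (Suc k) m (\<lambda>x. f (inst t x)) \<le> 0) \<Longrightarrow>
    mean (Suc k) M (\<lambda>x. f x * (\<Prod>j<r. indicat_real (D j) x)) \<le> \<gamma> / 2" by blast
  from tile_insensitive[OF dhj _ \<open>\<gamma> / 2 > 0\<close>, of "\<iota> r" M] Suc.prems(1) obtain n0 where n0:
    "\<And>n D f. n \<ge> n0 \<Longrightarrow> insensitive k (\<iota> r) n D \<Longrightarrow> (\<And>x. x \<in> words (Suc k) n \<Longrightarrow> f x \<le> 1) \<Longrightarrow>
    (\<And>t. template (Suc k) M n t \<Longrightarrow> mean (Suc k) M (\<lambda>x. f (inst t x)) \<le> 0) \<Longrightarrow>
    mean (Suc k) n (\<lambda>x. f x * indicat_real D x) \<le> \<gamma> / 2" by blast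
  show ?case
  proof (rule exI[of _ n0], intro allI impI)
    fix n D f
    assume n: "n0 \<le> n" and D: "\<forall>j<Suc r. insensitive k (\<iota> j) n (D j)"
      and f1: "\<forall>x\<in>words (Suc k) n. f x \<le> 1"
      and f: "\<forall>t. template (Suc k) m n t \<longrightarrow> mean (Suc k) m (\<lambda>x. f (inst t x)) \<le> 0"
    let ?P = "\<lambda>x. \<Prod>j<r. indicat_real (D j) x"
    have P01: "0 \<le> ?P x" "?P x \<le> 1" for x
      by (auto intro!: prod_nonneg prod_le_1 simp: indicat_le_1)
    define g where "g x = f x * ?P x - \<gamma> / 2" for x
    have "mean (Suc k) n (\<lambda>x. g x * indicat_real (D r) x) \<le> \<gamma> / 2"
    proof (rule n0[OF n])
      fix x assume x: "x \<in> words (Suc k) n"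
      have "f x * ?P x \<le> 1 * ?P x" using f1 x P01 by (intro mult_right_mono) auto
      then show "g x \<le> 1" using P01(2)[of x] \<open>\<gamma> / 2 > 0\<close> by (simp add: g_def)
    next
      fix t assume t: "template (Suc k) M n t"
      have "mean (Suc k) M (\<lambda>x. f (inst t x) * (\<Prod>j<r. indicat_real {x. inst t x \<in> D j} x)) \<le> \<gamma> / 2"
      proof (rule M)
        show "insensitive k (\<iota> j) M {x. inst t x \<in> D j}" if "j < r" for j
          using D Suc.prems(1) that by (intro insensitive_pullback[OF _ _ t]) auto
        show "f (inst t x) \<le> 1" if "x \<in> words (Suc k) M" for x
          using f1 inst_in_words[OF t order_refl that] by blast
        show "mean (Suc k) m (\<lambda>x. f (inst t (inst s x))) \<le> 0" if s: "template (Suc k) m M s" for s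
          using f[rule_format, OF template_comp[OF t s]] inst_comp[OF t templateD(1)[OF s]] by simp
      qed
      then show "mean (Suc k) M (\<lambda>x. g (inst t x)) \<le> 0"
        by (simp add: g_def mean_diff indicator_def)
    qed (use D in auto)
    moreover have "mean (Suc k) n (\<lambda>x. f x * (\<Prod>j<Suc r. indicat_real (D j) x))
      = mean (Suc k) n (\<lambda>x. g x * indicat_real (D r) x) + \<gamma> / 2 * mean (Suc k) n (indicat_real (D r))"
      unfolding mean_add[symmetric] mean_cmult[symmetric] by (simp add: g_def algebra_simps)
    moreover have "\<gamma> / 2 * mean (Suc k) n (indicat_real (D r)) \<le> \<gamma> / 2 * 1"
      using \<open>\<gamma> / 2 > 0\<close> by (intro mult_left_mono mean_le_const indicat_le_1) auto
    ultimately show "mean (Suc k) n (\<lambda>x. f x * (\<Prod>j<Suc r. indicat_real (D j) x)) \<le> \<gamma>"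
      by simp
  qed
qed

section \<open>Density Hales-Jewett: the induction on the alphabet\<close>

text \<open>By averaging, the random set of words w whose event E w occurs is dense with positive
  probability, and then contains one of finitely many lines.\<close>

lemma prob_density_hales_jewett:
  assumes dhj: "density_hales_jewett k" and k: "k > 0" and "\<delta> > 0"
  shows "\<exists>n. \<exists>\<theta>>0. \<forall>(M :: 'a measure) E. prob_space M \<longrightarrow>
       (\<forall>w\<in>words k n. E w \<in> sets M \<and> \<delta> \<le> measure M (E w)) \<longrightarrow>
       (\<exists>t. template k 1 n t \<and> \<theta> \<le> measure M (\<Inter>a<k. E (inst t [a])))"
proof -
  obtain n where n: "\<And>A. line_free k n A \<Longrightarrow> mean k n (indicat_real A) < \<delta> / 2"
    using dhj \<open>\<delta> > 0\<close> unfolding density_hales_jewett_def by (metis half_gt_zero order_refl)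
  define T where "T = {t. template k 1 n t}"
  define \<theta> where "\<theta> = \<delta> / (2 * (real (card T) + 1))"
  have "\<theta> > 0" using \<open>\<delta> > 0\<close> by (simp add: \<theta>_def)
  moreover have "\<exists>t. template k 1 n t \<and> \<theta> \<le> measure M (\<Inter>a<k. E (inst t [a]))"
    if "prob_space M" and E: "\<And>w. w \<in> words k n \<Longrightarrow> E w \<in> sets M \<and> \<delta> \<le> measure M (E w)"
    for M :: "'a measure" and E
  proof -
    interpret prob_space M by fact
    have E_sets [measurable]: "w \<in> words k n \<Longrightarrow> E w \<in> sets M" for w using E by blast
    define L where "L t = (\<Inter>a<k. E (inst t [a]))" for t
    have L: "L t \<in> sets M" if "t \<in> T" for t
      unfolding L_def
    proof (intro sets.finite_INT)
      show "E (inst t [a]) \<in> sets M" if "a \<in> {..<k}" for a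
        using that \<open>t \<in> T\<close> by (intro E_sets inst_in_words[of k 1 n t k]) (auto simp: T_def)
    qed (use k in auto)
    have pointwise: "mean k n (\<lambda>w. indicat_real (E w) \<omega>) \<le> \<delta> / 2 + (\<Sum>t\<in>T. indicat_real (L t) \<omega>)" for \<omega>
    proof (cases "line_free k n {w. \<omega> \<in> E w}")
      case True
      have "(\<lambda>w. indicat_real (E w) \<omega>) = indicat_real {w. \<omega> \<in> E w}" by (auto simp: indicator_def)
      moreover have "0 \<le> (\<Sum>t\<in>T. indicat_real (L t) \<omega>)" by (simp add: sum_nonneg)
      ultimately show ?thesis using n[OF True] by simp
    next
      case False
      then obtain t where t: "t \<in> T" "\<omega> \<in> L t"
        unfolding line_free_def T_def L_def by auto
      then have "1 \<le> (\<Sum>t\<in>T. indicat_real (L t) \<omega>)"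
        using member_le_sum[of t T "\<lambda>t. indicat_real (L t) \<omega>"] by (simp add: T_def)
      moreover have "mean k n (\<lambda>w. indicat_real (E w) \<omega>) \<le> 1"
        by (rule mean_le_const[OF k]) (simp add: indicator_def)
      ultimately show ?thesis using \<open>\<delta> > 0\<close> by linarith
    qed
    have int_E: "integrable M (indicat_real (E w))" if "w \<in> words k n" for w
      using E_sets[OF that] by (simp add: integrable_indicator_iff emeasure_eq_measure)
    have int_L: "integrable M (indicat_real (L t))" if "t \<in> T" for t
      using L[OF that] by (simp add: integrable_indicator_iff emeasure_eq_measure)
    have "\<delta> \<le> mean k n (\<lambda>w. measure M (E w))"
      using mean_mono[of k n "\<lambda>_. \<delta>" "\<lambda>w. measure M (E w)"] E k by simp
    also have "\<dots> = (\<integral>\<omega>. mean k n (\<lambda>w. indicat_real (E w) \<omega>) \<partial>M)"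
      unfolding mean_def using int_E E_sets by (simp add: Bochner_Integration.integral_sum)
    also have "\<dots> \<le> (\<integral>\<omega>. \<delta> / 2 + (\<Sum>t\<in>T. indicat_real (L t) \<omega>) \<partial>M)"
      using int_E int_L by (intro integral_mono pointwise) (auto simp: mean_def)
    also have "\<dots> = \<delta> / 2 + (\<Sum>t\<in>T. measure M (L t))"
      using int_L L by (simp add: Bochner_Integration.integral_sum prob_space)
    finally have *: "\<delta> / 2 \<le> (\<Sum>t\<in>T. measure M (L t))" by simp
    show "\<exists>t. template k 1 n t \<and> \<theta> \<le> measure M (\<Inter>a<k. E (inst t [a]))"
    proof (rule ccontr)
      assume "\<not> ?thesis"
      then have "(\<Sum>t\<in>T. measure M (L t)) \<le> (\<Sum>t\<in>T. \<theta>)"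
        by (intro sum_mono) (auto simp: T_def L_def not_le intro: less_imp_le)
      also have "\<dots> < \<delta> / 2" using \<open>\<delta> > 0\<close> by (simp add: \<theta>_def field_simps)
      finally show False using * by simp
    qed
  qed
  ultimately show ?thesis by blast
qed

lemma measure_uniform_words:
  assumes "k > 0"
  shows "measure (measure_pmf (pmf_of_set (words k n))) S = mean k n (indicat_real S)"
proof -
  have "words k n \<noteq> {}" using card_words[of k n] assms by (metis card.empty power_eq_0_iff less_numeral_extra(3))
  then show ?thesis
    by (simp add: measure_pmf_of_set mean_def indicator_def Int_def)
qed

lemma word_to_line:
  assumes x: "x \<in> words (Suc k) n" and "k \<in> set x"
  obtains t where "template k 1 n t" "\<forall>a. inst t [a] = merge k a x"
proof
  let ?t = "map (\<lambda>a. if a = k then Inr 0 else Inl a) x :: (nat + nat) list"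
  show "template k 1 n ?t"
    using assms by (auto simp: template_def words_def image_iff less_Suc_eq)
  show "\<forall>a. inst ?t [a] = merge k a x"
    by (simp add: inst_def merge_def)
qed

lemma line_to_word:
  assumes t: "template k 1 n t"
  shows "inst t [k] \<in> words (Suc k) n" "k \<in> set (inst t [k])" "a < k \<Longrightarrow> merge k a (inst t [k]) = inst t [a]"
proof -
  show "inst t [k] \<in> words (Suc k) n"
    using inst_in_words[OF t, of "Suc k" "[k]"] by simp
  show "k \<in> set (inst t [k])" using var_value_in_inst[OF t, of "[k]"] by simp
  show "merge k a (inst t [k]) = inst t [a]"
    using inst_merge[OF t, of "[k]" a] by (simp add: merge_def)
qed

text \<open>A word x over k + 1 letters is read as a line over k letters with wildcard k; these
  are the words whose lines have all their k points in A. A word without the letter k counts as a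
  degenerate line.\<close>

definition good_lines :: "nat \<Rightarrow> nat list set \<Rightarrow> nat list set" where
  "good_lines k A = {x. \<forall>i<k. merge k i x \<in> A}"

lemma sum_first_failure:
  fixes d :: "nat \<Rightarrow> real"
  shows "(\<Sum>i<k. (\<Prod>j<i. d j) * (1 - d i)) = 1 - (\<Prod>j<k. d j)"
  by (induction k) (simp_all add: algebra_simps)

lemma mean_words_smaller: "mean (Suc k) n (indicat_real (words k n)) = (real k / real (Suc k)) ^ n"
proof -
  have "words (Suc k) n \<inter> words k n = words k n" using words_mono[of k "Suc k" n] by auto
  then show ?thesis
    by (simp add: mean_def indicator_def power_divide del: of_nat_Suc)
qed

text \<open>If x lies in A and describes a line all of whose k points lie in A, then x completes
  this line unless x does not contain the letter k, which is rare. So A lies essentially outside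
  \<open>good_lines k A\<close>, the intersection of the sets D j = {x. merge k j x
  \<in> A} for j < k. Its complement is split according to the first i with x
  \<notin> D i. Each part is an intersection of insensitive sets and so tiled by
  subspaces, on which A has density at most \<alpha>.\<close>

lemma line_free_density_bound:
  assumes dhj: "density_hales_jewett k" and k: "k > 0" and "\<gamma> > 0" and "\<alpha> \<ge> 0"
    and \<alpha>: "\<And>B. line_free (Suc k) m B \<Longrightarrow> mean (Suc k) m (indicat_real B) \<le> \<alpha>"
  shows "\<exists>n0. \<forall>n\<ge>n0. \<forall>A. line_free (Suc k) n A \<longrightarrow>
    mean (Suc k) n (indicat_real A) \<le> (1 - mean (Suc k) n (indicat_real (good_lines k A))) * \<alpha> + \<gamma>"
proof -
  let ?K = "Suc k"
  define \<gamma>' where "\<gamma>' = \<gamma> / 2 / real k"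
  have "\<gamma>' > 0" using \<open>\<gamma> > 0\<close> k by (simp add: \<gamma>'_def)
  define Q where "Q i n0 \<longleftrightarrow> (\<forall>n\<ge>n0. \<forall>D f. (\<forall>j<Suc i. insensitive k j n (D j)) \<longrightarrow>
    (\<forall>x\<in>words ?K n. f x \<le> 1) \<longrightarrow> (\<forall>t. template ?K m n t \<longrightarrow> mean ?K m (\<lambda>x. f (inst t x)) \<le> 0) \<longrightarrow>
    mean ?K n (\<lambda>x. f x * (\<Prod>j<Suc i. indicat_real (D j) x)) \<le> \<gamma>')" for i n0
  have "\<exists>n0. Q i n0" if "i < k" for i
    unfolding Q_def using that \<open>\<gamma>' > 0\<close> by (intro tile_intersection[OF dhj]) auto
  then obtain \<nu> where \<nu>: "\<And>i. i < k \<Longrightarrow> Q i (\<nu> i)" by metis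
  have "(\<lambda>n. (real k / real ?K) ^ n) \<longlonglongrightarrow> 0"
    by (intro LIMSEQ_realpow_zero) auto
  then have "\<forall>\<^sub>F n in sequentially. (real k / real ?K) ^ n < \<gamma> / 2"
    by (rule order_tendstoD) (use \<open>\<gamma> > 0\<close> in simp)
  then obtain n1 where n1: "\<And>n. n \<ge> n1 \<Longrightarrow> (real k / real ?K) ^ n < \<gamma> / 2"
    by (auto simp: eventually_sequentially)
  show ?thesis
  proof (rule exI[of _ "max n1 (Max (\<nu> ` {..<k}))"], intro allI impI)
    fix n A assume n: "max n1 (Max (\<nu> ` {..<k})) \<le> n" and A: "line_free ?K n A"
    have n_\<nu>: "\<nu> i \<le> n" if "i < k" for i
      using n that by (meson Max_ge finite_imageI finite_lessThan imageI lessThan_iff max.bounded_iff order_trans)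
    define f where "f x = indicat_real A x - \<alpha>" for x
    define D where "D j = {x. merge k j x \<in> A}" for j
    define d where "d j x = indicat_real (D j) x" for j x
    have ins: "insensitive k j n (D j)" "insensitive k j n (- D j)" if "j < k" for j
      using that by (auto simp: insensitive_def D_def)
    have f0: "mean ?K m (\<lambda>x. f (inst t x)) \<le> 0" if t: "template ?K m n t" for t
    proof -
      have "line_free ?K m {x. inst t x \<in> A}"
        unfolding line_free_def
      proof
        assume "\<exists>s. template ?K 1 m s \<and> (\<forall>a<?K. inst s [a] \<in> {x. inst t x \<in> A})"
        then obtain s where s: "template ?K 1 m s" "\<And>a. a < ?K \<Longrightarrow> inst t (inst s [a]) \<in> A" by auto
        then show False
          using A template_comp[OF t s(1)] inst_comp[OF t templateD(1)[OF s(1)]]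
          unfolding line_free_def by metis
      qed
      moreover have "indicat_real A (inst t x) = indicat_real {x. inst t x \<in> A} x" for x
        by (simp add: indicator_def)
      ultimately show ?thesis using \<alpha> by (simp add: f_def mean_diff)
    qed
    have part: "mean ?K n (\<lambda>x. f x * ((\<Prod>j<i. d j x) * (1 - d i x))) \<le> \<gamma>'" if "i < k" for i
    proof -
      have "mean ?K n (\<lambda>x. f x * (\<Prod>j<Suc i. indicat_real (if j < i then D j else - D j) x)) \<le> \<gamma>'"
      proof (rule \<nu>[OF that, unfolded Q_def, rule_format, OF n_\<nu>[OF that]])
        show "insensitive k j n (if j < i then D j else - D j)" if "j < Suc i" for j
          using ins[of j] that \<open>i < k\<close> by simp
        show "f x \<le> 1" for x using \<open>\<alpha> \<ge> 0\<close> by (simp add: f_def indicator_def)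
      qed (rule f0)
      moreover have "(\<Prod>j<Suc i. indicat_real (if j < i then D j else - D j) x) = (\<Prod>j<i. d j x) * (1 - d i x)" for x
        by (auto simp: d_def indicator_def)
      ultimately show ?thesis by simp
    qed
    have good: "(\<Prod>j<k. d j x) = indicat_real (good_lines k A) x" for x
      by (auto simp: d_def D_def good_lines_def indicator_def prod_eq_1_iff)
    have "mean ?K n (\<lambda>x. f x * (1 - indicat_real (good_lines k A) x))
      = (\<Sum>i<k. mean ?K n (\<lambda>x. f x * ((\<Prod>j<i. d j x) * (1 - d i x))))"
      unfolding mean_sum[symmetric] sum_distrib_left[symmetric] good[symmetric] sum_first_failure ..
    also have "\<dots> \<le> (\<Sum>i<k. \<gamma>')" by (intro sum_mono part) simp
    also have "\<dots> = \<gamma> / 2" using k by (simp add: \<gamma>'_def)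
    finally have bad: "mean ?K n (\<lambda>x. f x * (1 - indicat_real (good_lines k A) x)) \<le> \<gamma> / 2" .
    have "indicat_real A x \<le> f x * (1 - indicat_real (good_lines k A) x)
        + (\<alpha> * (1 - indicat_real (good_lines k A) x) + indicat_real (words k n) x)"
      if x: "x \<in> words ?K n" for x
    proof (cases "x \<in> A \<and> x \<in> good_lines k A")
      case True
      have "k \<notin> set x"
      proof
        assume "k \<in> set x"
        with x obtain t where t: "template k 1 n t" "\<forall>a. inst t [a] = merge k a x"
          by (rule word_to_line)
        have "merge k a x \<in> A" if "a < Suc k" for a
          using True that by (cases "a = k") (auto simp: good_lines_def merge_def)
        then show False
          using A template_mono[OF t(1), of "Suc k"] t(2) unfolding line_free_def by auto
      qed
      then have "x \<in> words k n" using x by (force simp: words_def less_Suc_eq)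
      then show ?thesis using True by simp
    qed (auto simp: f_def indicator_def)
    then have "mean ?K n (indicat_real A) \<le> mean ?K n (\<lambda>x. f x * (1 - indicat_real (good_lines k A) x)
        + (\<alpha> * (1 - indicat_real (good_lines k A) x) + indicat_real (words k n) x))"
      by (intro mean_mono)
    also have "\<dots> = mean ?K n (\<lambda>x. f x * (1 - indicat_real (good_lines k A) x))
        + (\<alpha> * (1 - mean ?K n (indicat_real (good_lines k A))) + (real k / real ?K) ^ n)"
      by (simp only: mean_add mean_cmult mean_diff mean_words_smaller mean_const[OF zero_less_Suc])
    also have "\<dots> \<le> \<gamma> / 2 + (\<alpha> * (1 - mean ?K n (indicat_real (good_lines k A))) + \<gamma> / 2)"
      using bad n1[of n] n by (intro add_mono) auto
    finally show "mean ?K n (indicat_real A) \<le> (1 - mean ?K n (indicat_real (good_lines k A))) * \<alpha> + \<gamma>"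
      by (simp add: mult.commute)
  qed
qed

text \<open>Suppose that all fibres of A above words w of length n are dense, and colour a line of
  such words according to whether its k points have at least a proportion \<theta>
  of common continuations. In a subspace where all lines have the same colour they are all good,
  because \<open>prob_density_hales_jewett\<close>, applied to the fibres as events, finds one
  good line. The bound \<theta> does not depend on m; this matters because the
  dimension m is chosen later.\<close>

lemma good_subspace:
  assumes dhj: "density_hales_jewett k" and k: "k > 0" and "\<delta> > 0"
  obtains m0 \<theta> where "\<theta> > 0" "\<And>m. m \<ge> m0 \<Longrightarrow> \<exists>n. \<forall>n' A.
    (\<forall>w\<in>words (Suc k) n. \<delta> \<le> mean (Suc k) n' (\<lambda>s. indicat_real A (w @ s))) \<longrightarrow>
    (\<exists>t. template k m n t \<and> (\<forall>x\<in>words (Suc k) m. k \<in> set x \<longrightarrow>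
       \<theta> \<le> mean (Suc k) n' (\<lambda>s. indicat_real (good_lines k {y. y @ s \<in> A}) (inst t x))))"
proof -
  obtain m0 \<theta> where "\<theta> > 0" and P: "\<forall>(M :: nat list measure) E. prob_space M \<longrightarrow>
       (\<forall>w\<in>words k m0. E w \<in> sets M \<and> \<delta> \<le> measure M (E w)) \<longrightarrow>
       (\<exists>t. template k 1 m0 t \<and> \<theta> \<le> measure M (\<Inter>a<k. E (inst t [a])))"
    using prob_density_hales_jewett[OF dhj k \<open>\<delta> > 0\<close>, where 'a = "nat list"] by blast
  show thesis
  proof (rule that[OF \<open>\<theta> > 0\<close>])
    fix m assume "m0 \<le> m"
    obtain u where u: "template k m0 m u" using template_initial[OF k \<open>m0 \<le> m\<close>] .
    obtain n where n: "\<forall>c. (\<forall>x\<in>words (Suc k) n. c x < (2::nat)) \<longrightarrow> (\<exists>t. template k m n t \<and>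
      (\<forall>(x, y)\<in>{(x, y). x \<in> words (Suc k) m \<and> y \<in> words (Suc k) m \<and> k \<in> set x \<and> k \<in> set y}.
        c (inst t x) = c (inst t y)))"
      using ramseyD[OF graham_rothschild[OF k, of m]] by blast
    show "\<exists>n. \<forall>n' A. (\<forall>w\<in>words (Suc k) n. \<delta> \<le> mean (Suc k) n' (\<lambda>s. indicat_real A (w @ s))) \<longrightarrow>
      (\<exists>t. template k m n t \<and> (\<forall>x\<in>words (Suc k) m. k \<in> set x \<longrightarrow>
         \<theta> \<le> mean (Suc k) n' (\<lambda>s. indicat_real (good_lines k {y. y @ s \<in> A}) (inst t x))))"
    proof (rule exI[of _ n], intro allI impI)
      fix n' A assume A: "\<forall>w\<in>words (Suc k) n. \<delta> \<le> mean (Suc k) n' (\<lambda>s. indicat_real A (w @ s))"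
      define G where "G z = mean (Suc k) n' (\<lambda>s. indicat_real (good_lines k {y. y @ s \<in> A}) z)" for z
      define c :: "nat list \<Rightarrow> nat" where "c z = of_bool (\<theta> \<le> G z)" for z
      have "\<forall>x\<in>words (Suc k) n. c x < 2" by (simp add: c_def)
      with n obtain t where t: "template k m n t"
        "\<And>x y. x \<in> words (Suc k) m \<Longrightarrow> y \<in> words (Suc k) m \<Longrightarrow> k \<in> set x \<Longrightarrow> k \<in> set y \<Longrightarrow>
        c (inst t x) = c (inst t y)" by blast
      define E where "E w = {s. inst t (inst u w) @ s \<in> A}" for w
      let ?M = "measure_pmf (pmf_of_set (words (Suc k) n'))"
      have "\<delta> \<le> measure ?M (E w)" if w: "w \<in> words k m0" for w
      proof -
        have "inst t (inst u w) \<in> words k n"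
          by (rule inst_in_words[OF t(1) order_refl inst_in_words[OF u order_refl w]])
        then have "inst t (inst u w) \<in> words (Suc k) n" using words_mono[of k "Suc k" n] by auto
        then show ?thesis using A by (simp add: measure_uniform_words E_def indicator_def indicat_Collect)
      qed
      then obtain v where v: "template k 1 m0 v" "\<theta> \<le> measure ?M (\<Inter>a<k. E (inst v [a]))"
        using P[rule_format, OF measure_pmf.prob_space_axioms, of E] by auto
      define x0 where "x0 = inst u (inst v [k])"
      have vk: "inst v [k] \<in> words (Suc k) m0" "k \<in> set (inst v [k])" using line_to_word[OF v(1)] by auto
      have x0: "x0 \<in> words (Suc k) m" "k \<in> set x0"
        using inst_in_words[OF u _ vk(1)] subsetD[OF var_value_in_inst[OF u length_words[OF vk(1)]] vk(2)]
        by (auto simp: x0_def)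
      have "merge k a (inst t x0) = inst t (inst u (inst v [a]))" if "a < k" for a
        using line_to_word(3)[OF v(1) that] inst_merge[OF t(1) length_words[OF x0(1)], of a]
          inst_merge[OF u length_words[OF vk(1)], of a] by (simp add: x0_def)
      then have "(\<Inter>a<k. E (inst v [a])) = {s. inst t x0 \<in> good_lines k {y. y @ s \<in> A}}"
        by (auto simp: E_def good_lines_def)
      then have "\<theta> \<le> G (inst t x0)"
        using v(2) by (simp add: measure_uniform_words G_def indicator_def indicat_Collect)
      then have "\<theta> \<le> G (inst t x)" if "x \<in> words (Suc k) m" "k \<in> set x" for x
        using t(2)[OF that(1) x0(1) that(2) x0(2)] by (simp add: c_def of_bool_def split: if_splits)
      with t(1) show "\<exists>t. template k m n t \<and> (\<forall>x\<in>words (Suc k) m. k \<in> set x \<longrightarrow>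
         \<theta> \<le> mean (Suc k) n' (\<lambda>s. indicat_real (good_lines k {y. y @ s \<in> A}) (inst t x)))"
        unfolding G_def by blast
    qed
  qed
qed

text \<open>Let \<delta> be the infimum of the asymptotic upper bounds for the
  density of line-free sets. If it is positive, take a line-free A of density nearly
  \<delta> in words of length N + n'. Since no fibre is much denser than
  \<delta>, none can be much sparser. By \<open>good_subspace\<close> there is an
  m-dimensional subspace t of the words of length N whose lines are all good. For each
  continuation s let B s be the trace of A on t. On average over s it has density about
  \<delta>, and on average at least about \<theta> of the words
  describe lines inside B s. This contradicts the bound for line-free sets from
  \<open>line_free_density_bound\<close>.\<close>

lemma density_hales_jewett_Suc:
  assumes dhj: "density_hales_jewett k" and k: "k > 0"
  shows "density_hales_jewett (Suc k)"
proof -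
  let ?K = "Suc k"
  define bound where "bound \<beta> \<longleftrightarrow> (\<exists>n0. \<forall>n\<ge>n0. \<forall>A. line_free ?K n A \<longrightarrow> mean ?K n (indicat_real A) \<le> \<beta>)" for \<beta>
  define \<delta> where "\<delta> = Inf {\<beta>. 0 \<le> \<beta> \<and> bound \<beta>}"
  have "bound 1" unfolding bound_def by (auto intro!: mean_le_const indicat_le_1)
  then have ne: "{\<beta>. 0 \<le> \<beta> \<and> bound \<beta>} \<noteq> {}" by force
  have bdd: "bdd_below {\<beta>. 0 \<le> \<beta> \<and> bound \<beta>}" by (rule bdd_belowI[of _ 0]) auto
  have "\<delta> \<ge> 0" unfolding \<delta>_def using ne by (intro cInf_greatest) auto
  have upper: "bound (\<delta> + \<epsilon>)" if "\<epsilon> > 0" for \<epsilon>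
  proof -
    have "Inf {\<beta>. 0 \<le> \<beta> \<and> bound \<beta>} < \<delta> + \<epsilon>" using that by (simp add: \<delta>_def)
    from cInf_lessD[OF ne this] obtain \<beta> where "\<beta> < \<delta> + \<epsilon>" "bound \<beta>" by auto
    then show ?thesis unfolding bound_def by (meson less_imp_le order_trans)
  qed
  have lower: "\<exists>n\<ge>n0. \<exists>A. line_free ?K n A \<and> \<delta> - \<epsilon> < mean ?K n (indicat_real A)"
    if "\<epsilon> > 0" "\<epsilon> \<le> \<delta>" for \<epsilon> n0
  proof (rule ccontr)
    assume "\<not> ?thesis"
    then have "bound (\<delta> - \<epsilon>)" unfolding bound_def by (intro exI[of _ n0]) (auto simp: not_less)
    then have "\<delta> \<le> \<delta> - \<epsilon>" unfolding \<delta>_def[symmetric]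
      using cInf_lower[OF _ bdd, of "\<delta> - \<epsilon>"] that by (simp add: \<delta>_def[symmetric])
    then show False using that by simp
  qed
  have "\<delta> = 0"
  proof (rule ccontr)
    assume "\<delta> \<noteq> 0"
    then have "\<delta> > 0" "\<delta> / 2 > 0" using \<open>\<delta> \<ge> 0\<close> by auto
    obtain m0 \<theta> where "\<theta> > 0" and good: "\<And>m. m \<ge> m0 \<Longrightarrow> \<exists>n. \<forall>n' A.
      (\<forall>w\<in>words ?K n. \<delta> / 2 \<le> mean ?K n' (\<lambda>s. indicat_real A (w @ s))) \<longrightarrow>
      (\<exists>t. template k m n t \<and> (\<forall>x\<in>words ?K m. k \<in> set x \<longrightarrow>
         \<theta> \<le> mean ?K n' (\<lambda>s. indicat_real (good_lines k {y. y @ s \<in> A}) (inst t x))))"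
      by (rule good_subspace[OF dhj k \<open>\<delta> / 2 > 0\<close>]) (rule that)
    \<comment> \<open>Small enough for the final comparison, which needs 3 \<tau> <
      \<open>\<theta>\<delta>/2\<close>, and for the fibres to have density at least
      \<open>\<delta>/2\<close>.\<close>
    define \<tau> where "\<tau> = min (\<theta> * \<delta> / 8) (\<delta> / 2)"
    have \<tau>: "0 < \<tau>" "\<tau> \<le> \<theta> * \<delta> / 8" "\<tau> \<le> \<delta> / 2" using \<open>\<theta> > 0\<close> \<open>\<delta> > 0\<close> by (auto simp: \<tau>_def)
    obtain m1 where m1: "\<And>B. line_free ?K m1 B \<Longrightarrow> mean ?K m1 (indicat_real B) \<le> \<delta> + \<tau>"
      using upper[OF \<tau>(1)] unfolding bound_def by blast
    have "0 \<le> \<delta> + \<tau>" using \<tau> \<open>\<delta> > 0\<close> by simp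
    obtain m2 where m2: "\<And>m A. m \<ge> m2 \<Longrightarrow> line_free ?K m A \<Longrightarrow> mean ?K m (indicat_real A)
        \<le> (1 - mean ?K m (indicat_real (good_lines k A))) * (\<delta> + \<tau>) + \<tau>"
      using line_free_density_bound[OF dhj k \<tau>(1) \<open>0 \<le> \<delta> + \<tau>\<close> m1] by blast
    have "(\<lambda>m. (real k / real ?K) ^ m) \<longlonglongrightarrow> 0"
      by (intro LIMSEQ_realpow_zero) auto
    then have "\<forall>\<^sub>F m in sequentially. (real k / real ?K) ^ m < 1 / 2"
      by (rule order_tendstoD) simp
    then obtain m3 where m3: "\<And>m. m \<ge> m3 \<Longrightarrow> (real k / real ?K) ^ m < 1 / 2"
      by (auto simp: eventually_sequentially)
    define m where "m = max m0 (max m2 m3)"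
    obtain N where N: "\<And>n' A.
      (\<forall>w\<in>words ?K N. \<delta> / 2 \<le> mean ?K n' (\<lambda>s. indicat_real A (w @ s))) \<Longrightarrow>
      (\<exists>t. template k m N t \<and> (\<forall>x\<in>words ?K m. k \<in> set x \<longrightarrow>
         \<theta> \<le> mean ?K n' (\<lambda>s. indicat_real (good_lines k {y. y @ s \<in> A}) (inst t x))))"
      using good[of m] unfolding m_def by auto
    \<comment> \<open>All fibres have density at most \<open>\<delta> + \<epsilon>\<close> and
      their mean exceeds \<open>\<delta> - \<epsilon>\<close>. As there are (k+1)^N of them, this
      \<epsilon> forces each to have density at least \<open>\<delta> -
      \<tau>\<close>.\<close>
    define \<epsilon> where "\<epsilon> = \<tau> / (2 * real (?K ^ N))"
    have "real (?K ^ N) > 0" by simp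
    then have \<epsilon>: "0 < \<epsilon>" "2 * real (?K ^ N) * \<epsilon> = \<tau>" using \<tau> unfolding \<epsilon>_def by (simp_all add: field_simps)
    have "1 \<le> real (?K ^ N)" using one_le_power[of "real ?K" N] by simp
    then have "\<epsilon> \<le> real (?K ^ N) * \<epsilon>" using \<epsilon>(1) by (simp add: mult_le_cancel_right1 del: of_nat_power)
    then have "\<epsilon> \<le> \<delta>" using \<epsilon> \<tau> \<open>\<delta> > 0\<close> by linarith
    obtain n1 where n1: "\<And>n B. n \<ge> n1 \<Longrightarrow> line_free ?K n B \<Longrightarrow> mean ?K n (indicat_real B) \<le> \<delta> + \<epsilon>"
      using upper[OF \<epsilon>(1)] unfolding bound_def by blast
    obtain n A where n: "N + n1 \<le> n" and A: "line_free ?K n A" "\<delta> - \<epsilon> < mean ?K n (indicat_real A)"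
      using lower[OF \<epsilon>(1) \<open>\<epsilon> \<le> \<delta>\<close>] by blast
    then obtain n' where n': "n = N + n'" "n1 \<le> n'"
      by (metis add_le_cancel_left le_iff_add add.assoc)
    have line_free_fibre: "line_free ?K m' {x. inst t x @ s \<in> A}"
      if t: "template ?K m' N t" and s: "s \<in> words ?K n'" for t m' s
      unfolding line_free_def
    proof
      assume "\<exists>u. template ?K 1 m' u \<and> (\<forall>a<?K. inst u [a] \<in> {x. inst t x @ s \<in> A})"
      then obtain u where u: "template ?K 1 m' u" "\<And>a. a < ?K \<Longrightarrow> inst t (inst u [a]) @ s \<in> A" by auto
      have "template ?K 1 n (comp_template t u @ map Inl s)"
        unfolding n' by (rule template_append_const[OF template_comp[OF t u(1)] s])
      moreover have "inst (comp_template t u @ map Inl s) [a] \<in> A" if "a < ?K" for a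
        using u(2)[OF that] inst_comp[OF t templateD(1)[OF u(1)]] by simp
      ultimately show False using A(1) unfolding line_free_def by blast
    qed
    define \<phi> where "\<phi> w = mean ?K n' (\<lambda>s. indicat_real A (w @ s))" for w
    have \<phi>_upper: "\<phi> w \<le> \<delta> + \<epsilon>" if w: "w \<in> words ?K N" for w
    proof -
      have "line_free ?K n' {s. w @ s \<in> A}"
        unfolding line_free_def
      proof
        assume "\<exists>u. template ?K 1 n' u \<and> (\<forall>a<?K. inst u [a] \<in> {s. w @ s \<in> A})"
        then obtain u where u: "template ?K 1 n' u" "\<And>a. a < ?K \<Longrightarrow> w @ inst u [a] \<in> A" by auto
        then show False
          using A(1) template_prepend_const[OF u(1) w] unfolding line_free_def n' by auto
      qed
      from n1[OF n'(2) this] show ?thesis by (simp add: \<phi>_def indicator_def indicat_Collect)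
    qed
    have \<phi>_lower: "\<delta> - \<tau> \<le> \<phi> w" if w: "w \<in> words ?K N" for w
    proof -
      have "(\<delta> - \<epsilon>) * real (?K ^ N) \<le> (\<Sum>v\<in>words ?K N. \<phi> v)"
        using A(2) unfolding n' mean_append \<phi>_def[symmetric]
        by (simp add: mean_def pos_less_divide_eq less_imp_le)
      also have "\<dots> = \<phi> w + (\<Sum>v\<in>words ?K N - {w}. \<phi> v)"
        using w by (simp add: sum.remove)
      also have "(\<Sum>v\<in>words ?K N - {w}. \<phi> v) \<le> (\<Sum>v\<in>words ?K N - {w}. \<delta> + \<epsilon>)"
        by (intro sum_mono \<phi>_upper) auto
      also have "\<dots> = (real (?K ^ N) - 1) * (\<delta> + \<epsilon>)"
        using w \<open>1 \<le> real (?K ^ N)\<close> by (simp add: card_Diff_singleton of_nat_diff)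
      finally have "\<delta> - 2 * real (?K ^ N) * \<epsilon> + \<epsilon> \<le> \<phi> w" by (simp add: algebra_simps del: of_nat_power)
      then show ?thesis using \<epsilon> by linarith
    qed
    have "\<forall>w\<in>words ?K N. \<delta> / 2 \<le> mean ?K n' (\<lambda>s. indicat_real A (w @ s))"
      using \<phi>_lower \<tau>(3) unfolding \<phi>_def[symmetric] by fastforce
    from N[OF this] obtain t where t: "template k m N t"
      and good_t: "\<And>x. x \<in> words ?K m \<Longrightarrow> k \<in> set x \<Longrightarrow>
         \<theta> \<le> mean ?K n' (\<lambda>s. indicat_real (good_lines k {y. y @ s \<in> A}) (inst t x))" by blast
    have t': "template ?K m N t" using template_mono[OF t] by simp
    define B where "B s = {x. inst t x @ s \<in> A}" for s
    define G where "G s = mean ?K m (indicat_real (good_lines k (B s)))" for s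
    have B_bound: "mean ?K m (indicat_real (B s)) \<le> (1 - G s) * (\<delta> + \<tau>) + \<tau>" if "s \<in> words ?K n'" for s
      unfolding G_def using line_free_fibre[OF t' that]
      by (intro m2) (auto simp: m_def B_def)
    have "\<delta> - \<tau> \<le> mean ?K m (\<lambda>x. \<phi> (inst t x))"
      using mean_mono[of ?K m "\<lambda>_. \<delta> - \<tau>" "\<lambda>x. \<phi> (inst t x)"] \<phi>_lower inst_in_words[OF t'] by simp
    also have "\<dots> = mean ?K n' (\<lambda>s. mean ?K m (indicat_real (B s)))"
      unfolding \<phi>_def by (subst mean_swap) (simp add: B_def indicator_def)
    also have "\<dots> \<le> mean ?K n' (\<lambda>s. (1 - G s) * (\<delta> + \<tau>) + \<tau>)"
      by (intro mean_mono B_bound)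
    also have "\<dots> = (1 - mean ?K n' G) * (\<delta> + \<tau>) + \<tau>"
    proof -
      have "mean ?K n' (\<lambda>s. (1 - G s) * (\<delta> + \<tau>) + \<tau>) = mean ?K n' (\<lambda>s. (\<delta> + \<tau>) * (1 - G s) + \<tau>)"
        by (simp add: mult.commute)
      also have "\<dots> = (\<delta> + \<tau>) * (1 - mean ?K n' G) + \<tau>"
        by (simp only: mean_add mean_cmult mean_diff mean_const[OF zero_less_Suc])
      finally show ?thesis by (simp add: mult.commute)
    qed
    also have "\<dots> \<le> (1 - \<theta> / 2) * (\<delta> + \<tau>) + \<tau>"
    proof -
      have "\<theta> * (1 - indicat_real (words k m) x)
          \<le> mean ?K n' (\<lambda>s. indicat_real (good_lines k (B s)) x)" if x: "x \<in> words ?K m" for x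
      proof (cases "k \<in> set x")
        case True
        have "inst t x \<in> good_lines k {y. y @ s \<in> A} \<longleftrightarrow> x \<in> good_lines k (B s)" for s
          using inst_merge[OF t length_words[OF x]] by (simp add: good_lines_def B_def)
        then have "indicat_real (good_lines k {y. y @ s \<in> A}) (inst t x) = indicat_real (good_lines k (B s)) x" for s
          by (simp add: indicator_def)
        moreover have "x \<notin> words k m" using True by (auto simp: words_def)
        ultimately show ?thesis using good_t[OF x True] by simp
      next
        case False
        then have "x \<in> words k m" using x by (force simp: words_def less_Suc_eq)
        then show ?thesis by (simp add: mean_nonneg)
      qed
      then have "mean ?K m (\<lambda>x. \<theta> * (1 - indicat_real (words k m) x))
          \<le> mean ?K m (\<lambda>x. mean ?K n' (\<lambda>s. indicat_real (good_lines k (B s)) x))"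
        by (intro mean_mono)
      also have "\<dots> = mean ?K n' G"
        unfolding G_def by (subst mean_swap) simp
      also have "mean ?K m (\<lambda>x. \<theta> * (1 - indicat_real (words k m) x)) = \<theta> * (1 - (real k / real ?K) ^ m)"
        by (simp only: mean_cmult mean_diff mean_words_smaller mean_const[OF zero_less_Suc])
      finally have "\<theta> * (1 - (real k / real ?K) ^ m) \<le> mean ?K n' G" .
      moreover have "\<theta> * (1 / 2) \<le> \<theta> * (1 - (real k / real ?K) ^ m)"
        using less_imp_le[OF m3[of m]] \<open>\<theta> > 0\<close> by (intro mult_left_mono) (simp_all add: m_def)
      ultimately have "\<theta> / 2 \<le> mean ?K n' G" by simp
      then show ?thesis using \<open>0 \<le> \<delta> + \<tau>\<close> by (intro add_right_mono mult_right_mono) auto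
    qed
    finally have "\<theta> * \<delta> / 2 + \<theta> * \<tau> / 2 \<le> 3 * \<tau>" by (simp add: field_simps)
    moreover have "0 < \<theta> * \<tau>" "0 < \<theta> * \<delta>" using \<open>\<theta> > 0\<close> \<tau> \<open>\<delta> > 0\<close> by auto
    ultimately show False using \<tau>(2) by linarith
  qed
  then have "bound \<epsilon>" if "\<epsilon> > 0" for \<epsilon> using upper[OF that] by simp
  show ?thesis
    unfolding density_hales_jewett_def
  proof (intro allI impI)
    fix \<epsilon> :: real assume "\<epsilon> > 0"
    then have "bound (\<epsilon> / 2)" using \<open>\<And>\<epsilon>. \<epsilon> > 0 \<Longrightarrow> bound \<epsilon>\<close> by simp
    then obtain n0 where "\<forall>n\<ge>n0. \<forall>A. line_free ?K n A \<longrightarrow> mean ?K n (indicat_real A) \<le> \<epsilon> / 2"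
      unfolding bound_def by blast
    then show "\<exists>n0. \<forall>n\<ge>n0. \<forall>A. line_free ?K n A \<longrightarrow> mean ?K n (indicat_real A) < \<epsilon>"
      using \<open>\<epsilon> > 0\<close> by (intro exI[of _ n0]) fastforce
  qed
qed

theorem density_hales_jewett: "k > 0 \<Longrightarrow> density_hales_jewett k"
proof (induction k)
  case (Suc k)
  then show ?case
    using density_hales_jewett_1 density_hales_jewett_Suc[of k] by (cases "k = 0") auto
qed simp

section \<open>Integer powers of an invertible measure preserving map\<close>

lemma inverse_on_space:
  assumes "invertible_measure_preserving M T" "x \<in> space M"
  shows "T x \<in> space M" "the_inv_into (space M) T x \<in> space M"
    "T (the_inv_into (space M) T x) = x" "the_inv_into (space M) T (T x) = x"
  using assms unfolding invertible_measure_preserving_def bij_betw_def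
  by (auto intro: the_inv_into_into f_the_inv_into_f the_inv_into_f_f)

lemma int_iterate_0 [simp]: "int_iterate X T 0 x = x"
  by (simp add: int_iterate_def)

lemma int_iterate_in_space:
  assumes T: "invertible_measure_preserving M T" and "x \<in> space M"
  shows "int_iterate (space M) T k x \<in> space M"
proof -
  have "(T ^^ n) x \<in> space M" "(the_inv_into (space M) T ^^ n) x \<in> space M" for n
    by (induction n) (auto simp: assms inverse_on_space[OF T])
  then show ?thesis by (simp add: int_iterate_def)
qed

lemma int_iterate_plus_1:
  assumes T: "invertible_measure_preserving M T" and x: "x \<in> space M"
  shows "int_iterate (space M) T (k + 1) x = T (int_iterate (space M) T k x)"
proof (cases "k \<ge> 0")
  case True
  then show ?thesis by (simp add: int_iterate_def nat_add_distrib)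
next
  case False
  define j where "j = nat (- k - 1)"
  have k: "k = - int j - 1" using False by (simp add: j_def)
  have "(the_inv_into (space M) T ^^ j) x \<in> space M"
    using int_iterate_in_space[OF T x, of "- int j"] by (cases "j = 0") (auto simp: int_iterate_def x)
  moreover have "int_iterate (space M) T (k + 1) x = (the_inv_into (space M) T ^^ j) x"
    by (cases "j = 0") (auto simp: int_iterate_def k)
  moreover have "int_iterate (space M) T k x = the_inv_into (space M) T ((the_inv_into (space M) T ^^ j) x)"
  proof -
    have "nat (- k) = Suc j" "\<not> k \<ge> 0" by (simp_all add: k)
    then show ?thesis by (simp add: int_iterate_def)
  qed
  ultimately show ?thesis by (simp add: inverse_on_space[OF T])
qed

lemma int_iterate_add:
  assumes T: "invertible_measure_preserving M T" and x: "x \<in> space M"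
  shows "int_iterate (space M) T (a + b) x = int_iterate (space M) T a (int_iterate (space M) T b x)"
proof (induction a rule: int_induct[where k = 0])
  case (step1 i)
  then show ?case
    using int_iterate_plus_1[OF T x, of "i + b"]
      int_iterate_plus_1[OF T int_iterate_in_space[OF T x], of i b] by (simp add: algebra_simps)
next
  case (step2 i)
  have in_space: "int_iterate (space M) T (i - 1 + b) x \<in> space M"
    "int_iterate (space M) T (i - 1) (int_iterate (space M) T b x) \<in> space M"
    by (intro int_iterate_in_space[OF T] x)+
  have "T (int_iterate (space M) T (i - 1 + b) x)
      = T (int_iterate (space M) T (i - 1) (int_iterate (space M) T b x))"
    using step2 int_iterate_plus_1[OF T x, of "i - 1 + b"]
      int_iterate_plus_1[OF T int_iterate_in_space[OF T x], of "i - 1" b] by (simp add: algebra_simps)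
  then show ?case using in_space inverse_on_space(4)[OF T] by metis
qed simp

lemma shifted_set_add:
  assumes T: "invertible_measure_preserving M T"
  shows "shifted_set M T (a + b) A = shifted_set M T b (shifted_set M T a A)"
  using int_iterate_in_space[OF T] int_iterate_add[OF T]
  by (auto simp: shifted_set_def)

lemma shifted_set_INT: "I \<noteq> {} \<Longrightarrow> shifted_set M T k (\<Inter>i\<in>I. B i) = (\<Inter>i\<in>I. shifted_set M T k (B i))"
  by (auto simp: shifted_set_def)

lemma shifted_set_sets:
  assumes T: "invertible_measure_preserving M T" and A: "A \<in> sets M"
  shows "shifted_set M T k A \<in> sets M"
proof -
  have "T ^^ n \<in> measurable M M" "the_inv_into (space M) T ^^ n \<in> measurable M M" for n
  proof (induction n)
    case (Suc n)
    show "T ^^ Suc n \<in> measurable M M" "the_inv_into (space M) T ^^ Suc n \<in> measurable M M"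
      using T Suc by (auto simp: invertible_measure_preserving_def intro: measurable_comp)
  qed (simp_all add: id_def)
  then show ?thesis
    unfolding shifted_set_def int_iterate_def using A by (auto intro: measurable_sets)
qed

lemma emeasure_shifted_set:
  assumes T: "invertible_measure_preserving M T" and A: "A \<in> sets M"
  shows "emeasure M (shifted_set M T k A) = emeasure M A"
  using A
proof (induction k arbitrary: A rule: int_induct[where k = 0])
  case base
  then have "shifted_set M T 0 A = A"
    by (auto simp: shifted_set_def dest: sets.sets_into_space)
  then show ?case by simp
next
  case (step1 i)
  have "shifted_set M T 1 A = T -` A \<inter> space M" by (simp add: shifted_set_def int_iterate_def)
  then have "emeasure M (shifted_set M T 1 A) = emeasure M A"
    using T step1.prems by (simp add: invertible_measure_preserving_def)
  moreover have "shifted_set M T (i + 1) A = shifted_set M T i (shifted_set M T 1 A)"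
    using shifted_set_add[OF T, of 1 i A] by (simp add: add.commute)
  ultimately show ?case using step1 shifted_set_sets[OF T] by simp
next
  case (step2 i)
  let ?B = "shifted_set M T (i - 1) A"
  have "shifted_set M T i A = shifted_set M T 1 ?B"
    using shifted_set_add[OF T, of "i - 1" 1 A] by simp
  also have "\<dots> = T -` ?B \<inter> space M" by (simp add: shifted_set_def int_iterate_def)
  finally have "emeasure M (shifted_set M T i A) = emeasure M (T -` ?B \<inter> space M)" by simp
  also have "\<dots> = emeasure M ?B"
    using T shifted_set_sets[OF T step2.prems, of "i - 1"] unfolding invertible_measure_preserving_def by blast
  finally show ?case using step2.IH[OF step2.prems] by simp
qed

section \<open>Recurrence along finite sums\<close>

text \<open>Apply \<open>prob_density_hales_jewett\<close> to the sets
  T^(-\<phi>(w)) A, all of which have the measure of A. On a line with wildcard set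
  S the exponents are e a + c for the letters a, and the shift by the common term c does not
  change the measure of the intersection.\<close>

lemma recurrence_along_finite_sums:
  fixes p q :: "nat \<Rightarrow> int"
  assumes "prob_space M" and T: "invertible_measure_preserving M T"
    and A: "A \<in> sets M" "measure M A > 0"
  shows "\<exists>m. \<exists>\<theta>>0. \<forall>(u :: nat \<Rightarrow> nat) (v :: nat \<Rightarrow> nat). \<exists>S\<subseteq>{..<m}. S \<noteq> {} \<and>
    \<theta> \<le> measure M (\<Inter>j\<in>{0..l}. shifted_set M T (p j * int (\<Sum>i\<in>S. u i) + q j * int (\<Sum>i\<in>S. v i)) A)"
proof -
  obtain m \<theta> where "\<theta> > 0" and P: "\<forall>(M' :: 'a measure) E. prob_space M' \<longrightarrow>
       (\<forall>w\<in>words (Suc l) m. E w \<in> sets M' \<and> measure M A \<le> measure M' (E w)) \<longrightarrow>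
       (\<exists>t. template (Suc l) 1 m t \<and> \<theta> \<le> measure M' (\<Inter>a<Suc l. E (inst t [a])))"
    using prob_density_hales_jewett[OF density_hales_jewett[of "Suc l"] _ A(2), where 'a = 'a] by auto
  have "\<exists>S\<subseteq>{..<m}. S \<noteq> {} \<and>
    \<theta> \<le> measure M (\<Inter>j\<in>{0..l}. shifted_set M T (p j * int (\<Sum>i\<in>S. u i) + q j * int (\<Sum>i\<in>S. v i)) A)"
    for u v :: "nat \<Rightarrow> nat"
  proof -
    define \<phi> where "\<phi> w = (\<Sum>i<m. p (w ! i) * int (u i) + q (w ! i) * int (v i))" for w :: "nat list"
    define E where "E w = shifted_set M T (\<phi> w) A" for w
    have "\<forall>w\<in>words (Suc l) m. E w \<in> sets M \<and> measure M A \<le> measure M (E w)"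
      unfolding E_def using shifted_set_sets[OF T A(1)] emeasure_shifted_set[OF T A(1)]
      by (simp add: measure_def)
    with P \<open>prob_space M\<close> obtain t where t: "template (Suc l) 1 m t"
      "\<theta> \<le> measure M (\<Inter>a<Suc l. E (inst t [a]))" by blast
    define S where "S = {i. i < m \<and> t ! i = Inr 0}"
    have "S \<subseteq> {..<m}" "finite S" by (auto simp: S_def)
    have "Inr 0 \<in> set t" using templateD(4)[OF t(1), of 0] by simp
    then have "S \<noteq> {}" using templateD(1)[OF t(1)] by (auto simp: S_def in_set_conv_nth)
    define e where "e a = p a * int (\<Sum>i\<in>S. u i) + q a * int (\<Sum>i\<in>S. v i)" for a
    define c where "c = (\<Sum>i\<in>{..<m} - S. p (inst t [0] ! i) * int (u i) + q (inst t [0] ! i) * int (v i))"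
    have \<phi>_line: "\<phi> (inst t [a]) = e a + c" for a
    proof -
      have "\<phi> (inst t [a]) = (\<Sum>i\<in>S. p (inst t [a] ! i) * int (u i) + q (inst t [a] ! i) * int (v i))
        + (\<Sum>i\<in>{..<m} - S. p (inst t [a] ! i) * int (u i) + q (inst t [a] ! i) * int (v i))"
        unfolding \<phi>_def using sum.subset_diff[OF \<open>S \<subseteq> {..<m}\<close>, of "\<lambda>i. p (inst t [a] ! i) * int (u i) + q (inst t [a] ! i) * int (v i)"]
        by simp
      also have "(\<Sum>i\<in>S. p (inst t [a] ! i) * int (u i) + q (inst t [a] ! i) * int (v i)) = e a"
      proof -
        have "inst t [a] ! i = a" if "i \<in> S" for i
          using that templateD(1)[OF t(1)] by (simp add: S_def inst_def)
        then show ?thesis by (simp add: e_def sum.distrib sum_distrib_left)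
      qed
      also have "(\<Sum>i\<in>{..<m} - S. p (inst t [a] ! i) * int (u i) + q (inst t [a] ! i) * int (v i)) = c"
        unfolding c_def
      proof (rule sum.cong[OF refl])
        fix i assume i: "i \<in> {..<m} - S"
        have "inst t [a] ! i = inst t [0] ! i"
        proof (cases "t ! i")
          case (Inl b)
          then show ?thesis using i templateD(1)[OF t(1)] by (simp add: inst_def)
        next
          case (Inr j)
          then have "Inr j \<in> set t" using i templateD(1)[OF t(1)] by (metis DiffD1 lessThan_iff nth_mem)
          then show ?thesis using i Inr templateD(3)[OF t(1), of j] by (simp add: S_def)
        qed
        then show "p (inst t [a] ! i) * int (u i) + q (inst t [a] ! i) * int (v i)
          = p (inst t [0] ! i) * int (u i) + q (inst t [0] ! i) * int (v i)" by simp
      qed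
      finally show ?thesis .
    qed
    have "(\<Inter>a<Suc l. E (inst t [a])) = shifted_set M T c (\<Inter>a\<in>{0..l}. shifted_set M T (e a) A)"
      by (subst shifted_set_INT) (auto simp: E_def \<phi>_line shifted_set_add[OF T])
    moreover have "(\<Inter>a\<in>{0..l}. shifted_set M T (e a) A) \<in> sets M"
      by (intro sets.finite_INT shifted_set_sets[OF T A(1)]) auto
    ultimately have "\<theta> \<le> measure M (\<Inter>a\<in>{0..l}. shifted_set M T (e a) A)"
      using t(2) emeasure_shifted_set[OF T] by (simp add: measure_def)
    then show ?thesis
      using \<open>S \<subseteq> {..<m}\<close> \<open>S \<noteq> {}\<close> unfolding e_def by blast
  qed
  with \<open>\<theta> > 0\<close> show ?thesis by blast
qed

lemma few_large_values:
  fixes f :: "nat \<Rightarrow> real"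
  assumes "finite X" "\<And>n. n \<in> X \<Longrightarrow> 0 \<le> f n" "\<theta> > 0" "(\<Sum>n\<in>X. f n) < \<theta> * \<epsilon>"
  shows "real (card {n \<in> X. \<theta> \<le> f n}) < \<epsilon>"
proof -
  have "real (card {n \<in> X. \<theta> \<le> f n}) * \<theta> = (\<Sum>n | n \<in> X \<and> \<theta> \<le> f n. \<theta>)" by simp
  also have "\<dots> \<le> (\<Sum>n | n \<in> X \<and> \<theta> \<le> f n. f n)" by (rule sum_mono) simp
  also have "\<dots> \<le> (\<Sum>n\<in>X. f n)" using assms by (intro sum_mono2) auto
  also have "\<dots> < \<theta> * \<epsilon>" by fact
  finally show ?thesis using \<open>\<theta> > 0\<close> by (simp add: mult.commute)
qed

text \<open>Suppose that the N with large mean miss arbitrarily long intervals. Choose (u t, v t)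
  successively so that F < \<theta> at all nonempty finite sums: v t is taken in a
  long interval of bad N, so that adding any earlier finite sum of the v i stays in the interval.
  For each of the 2^t earlier sums, a value of u t up to v t is excluded only if it leads to one
  of the few large values of F. The constant c is such that these exclusions cannot exhaust {1..v
  t}. The invariant u \<le> v keeps the finite sums of u in the range over which
  the mean is taken.\<close>

lemma syndetic_from_finite_sums:
  fixes F :: "nat \<Rightarrow> nat \<Rightarrow> real"
  assumes F: "\<And>n N. 0 \<le> F n N" and "\<theta> > 0"
    and finite_sums: "\<And>u v. \<exists>S\<subseteq>{..<m}. S \<noteq> {} \<and> \<theta> \<le> F (\<Sum>i\<in>S. u i) (\<Sum>i\<in>S. v i)"
  defines "c \<equiv> \<theta> / 2 ^ (m + 2)"
  shows "\<exists>H. \<forall>a. \<exists>N\<in>{a..a + H}. N > 0 \<and> c \<le> 1 / real N * (\<Sum>n=1..N. F n N)"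
proof (rule ccontr)
  define P where "P N \<longleftrightarrow> N > 0 \<and> c \<le> 1 / real N * (\<Sum>n=1..N. F n N)" for N
  assume "\<not> ?thesis"
  then have thick: "\<exists>a. \<forall>N\<in>{a..a + H}. \<not> P N" for H unfolding P_def by blast
  have "\<exists>u v. (\<forall>i. u i \<le> v i) \<and> (\<forall>S\<subseteq>{..<t}. S \<noteq> {} \<longrightarrow> F (\<Sum>i\<in>S. u i) (\<Sum>i\<in>S. v i) < \<theta>)"
    if "t \<le> m" for t
    using that
  proof (induction t)
    case 0
    show ?case by (intro exI[of _ "\<lambda>_. 0"]) simp
  next
    case (Suc t)
    then obtain u v where uv: "\<And>i. u i \<le> v i"
      "\<And>S. S \<subseteq> {..<t} \<Longrightarrow> S \<noteq> {} \<Longrightarrow> F (\<Sum>i\<in>S. u i) (\<Sum>i\<in>S. v i) < \<theta>" by auto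
    define b where "b = (\<Sum>i<t. v i)"
    obtain a0 where a0: "\<And>N. N \<in> {a0..a0 + (2 * b + 1)} \<Longrightarrow> \<not> P N" using thick by blast
    \<comment> \<open>Starting b + 1 later ensures a > b, so that a plus an earlier sum is at most
      2 a.\<close>
    define a where "a = a0 + b + 1"
    have a: "b < a" "\<not> P (a + d)" if "d \<le> b" for d
      using a0[of "a + d"] that by (auto simp: a_def)
    have "0 < a" by (simp add: a_def)
    define bad where "bad S = {n \<in> {1..a + (\<Sum>i\<in>S. v i)}. \<theta> \<le> F n (a + (\<Sum>i\<in>S. v i))}" for S
    have bad: "real (card (bad S)) < real a / 2 ^ (m + 1)" if "S \<subseteq> {..<t}" for S
    proof -
      let ?N = "a + (\<Sum>i\<in>S. v i)"
      have "(\<Sum>i\<in>S. v i) \<le> b" unfolding b_def using that by (intro sum_mono2) auto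
      then have N: "\<not> P ?N" "?N \<le> 2 * a" "0 < ?N" using a[of "\<Sum>i\<in>S. v i"] \<open>0 < a\<close> by auto
      then have "1 / real ?N * (\<Sum>n=1..?N. F n ?N) < c" by (auto simp: P_def)
      moreover have "s < c * r" if "1 / r * s < c" "0 < r" for s r :: real
        using that by (simp add: field_simps)
      ultimately have "(\<Sum>n=1..?N. F n ?N) < c * real ?N" using N(3) by (simp del: of_nat_add of_nat_sum)
      also have "\<dots> \<le> c * real (2 * a)"
        using N(2) \<open>\<theta> > 0\<close> by (intro mult_left_mono of_nat_mono) (auto simp: c_def)
      also have "\<dots> = \<theta> * (real a / 2 ^ (m + 1))" by (simp add: c_def)
      finally show ?thesis
        unfolding bad_def by (intro few_large_values F \<open>\<theta> > 0\<close>) auto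
    qed
    define X where "X S = {n \<in> {1..a}. n + (\<Sum>i\<in>S. u i) \<in> bad S}" for S
    have "card (\<Union>S\<in>Pow {..<t}. X S) < a"
    proof -
      have card_X: "real (card (X S)) \<le> real a / 2 ^ (m + 1)" if "S \<subseteq> {..<t}" for S
      proof -
        have "card (X S) \<le> card (bad S)"
          by (rule card_inj_on_le[of "\<lambda>n. n + (\<Sum>i\<in>S. u i)"]) (auto simp: X_def bad_def inj_on_def)
        then show ?thesis using bad[OF that] by linarith
      qed
      have "real (card (\<Union>S\<in>Pow {..<t}. X S)) \<le> (\<Sum>S\<in>Pow {..<t}. real (card (X S)))"
        using card_UN_le[of "Pow {..<t}" X] unfolding of_nat_sum[symmetric] of_nat_le_iff by simp
      also have "\<dots> \<le> (\<Sum>S\<in>Pow {..<t}. real a / 2 ^ (m + 1))"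
        by (intro sum_mono card_X) auto
      also have "\<dots> = 2 ^ t * (real a / 2 ^ (m + 1))" by (simp add: card_Pow)
      also have "\<dots> < 2 ^ (m + 1) * (real a / 2 ^ (m + 1))"
        using Suc.prems \<open>0 < a\<close> by (intro mult_strict_right_mono power_strict_increasing) auto
      finally show ?thesis by simp
    qed
    moreover have "finite (\<Union>S\<in>Pow {..<t}. X S)" by (auto simp: X_def)
    ultimately have "\<not> {1..a} \<subseteq> (\<Union>S\<in>Pow {..<t}. X S)"
      using card_mono[of "\<Union>S\<in>Pow {..<t}. X S" "{1..a}"] by auto
    then obtain n where n: "1 \<le> n" "n \<le> a" "\<And>S. S \<subseteq> {..<t} \<Longrightarrow> n \<notin> X S" by fastforce
    define u' where "u' = u(t := n)"
    define v' where "v' = v(t := a)"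
    have "F (\<Sum>i\<in>S. u' i) (\<Sum>i\<in>S. v' i) < \<theta>" if S: "S \<subseteq> {..<Suc t}" "S \<noteq> {}" for S
    proof (cases "t \<in> S")
      case True
      define S' where "S' = S - {t}"
      have S': "S' \<subseteq> {..<t}" "S = insert t S'" "t \<notin> S'" "finite S'"
        using S True by (auto simp: S'_def less_Suc_eq finite_subset)
      have "(\<Sum>i\<in>S'. u' i) = (\<Sum>i\<in>S'. u i)" "(\<Sum>i\<in>S'. v' i) = (\<Sum>i\<in>S'. v i)"
        using S'(3) by (auto simp: u'_def v'_def intro!: sum.cong)
      then have sums: "(\<Sum>i\<in>S. u' i) = n + (\<Sum>i\<in>S'. u i)" "(\<Sum>i\<in>S. v' i) = a + (\<Sum>i\<in>S'. v i)"
        using S' by (simp_all add: u'_def v'_def)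
      have "(\<Sum>i\<in>S'. u i) \<le> (\<Sum>i\<in>S'. v i)" by (intro sum_mono uv)
      then have "n + (\<Sum>i\<in>S'. u i) \<in> {1..a + (\<Sum>i\<in>S'. v i)}" using n by simp
      moreover have "n + (\<Sum>i\<in>S'. u i) \<notin> bad S'" using n(1,2) n(3)[OF S'(1)] by (auto simp: X_def)
      ultimately show ?thesis unfolding sums bad_def by auto
    next
      case False
      then have "S \<subseteq> {..<t}" using S by (auto simp: less_Suc_eq)
      moreover have "(\<Sum>i\<in>S. u' i) = (\<Sum>i\<in>S. u i)" "(\<Sum>i\<in>S. v' i) = (\<Sum>i\<in>S. v i)"
        using False by (auto simp: u'_def v'_def intro!: sum.cong)
      ultimately show ?thesis using uv(2) S(2) by simp
    qed
    moreover have "u' i \<le> v' i" for i using uv(1) n(2) by (simp add: u'_def v'_def)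
    ultimately show ?case by blast
  qed
  from this[of m] obtain u v where
    "\<And>S. S \<subseteq> {..<m} \<Longrightarrow> S \<noteq> {} \<Longrightarrow> F (\<Sum>i\<in>S. u i) (\<Sum>i\<in>S. v i) < \<theta>" by auto
  with finite_sums[of u v] show False by (meson not_le)
qed

lemma syndetic_infinite_bounded_gaps:
  assumes "\<And>a. \<exists>N\<in>{a..a + H}. N \<in> S"
  shows "infinite S" "uniformly_bounded_gaps S"
proof -
  show "infinite S" unfolding infinite_nat_iff_unbounded_le
  proof
    fix a show "\<exists>N\<ge>a. N \<in> S" using assms[of a] by auto
  qed
  have "b - a \<le> Suc H" if "a < b" "S \<inter> {a<..<b} = {}" for a b
  proof -
    obtain N where N: "Suc a \<le> N" "N \<le> Suc a + H" "N \<in> S" using assms[of "Suc a"] by auto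
    then have "\<not> N < b" using that(2) by auto
    then show ?thesis using N by simp
  qed
  then show "uniformly_bounded_gaps S" unfolding uniformly_bounded_gaps_def by blast
qed

theorem theorem2p2:
  fixes M :: "'a measure" and T :: "'a \<Rightarrow> 'a"
    and l :: nat and p q :: "nat \<Rightarrow> int" and A :: "'a set"
  assumes "prob_space M" and "separable_measure M"
    and "invertible_measure_preserving M T"
    and "l \<ge> 1"
    and "p 0 = 0" and "q 0 = 0"
    and "\<forall>j\<in>{1..l}. p j \<noteq> 0"
    and "strict_mono_on {1..l} p"
    and "A \<in> sets M" and "measure M A > 0"
  shows "\<exists>\<N> :: nat set. \<N> \<subseteq> {0<..} \<and> infinite \<N> \<and> uniformly_bounded_gaps \<N> \<and>
           Liminf (inf sequentially (principal \<N>))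
             (\<lambda>N. ereal (1 / real N *
                (\<Sum>n=1..N. measure M
                   (\<Inter>j\<in>{0..l}. shifted_set M T (p j * int n + q j * int N) A)))) > 0"
proof -
  define F where "F n N = measure M (\<Inter>j\<in>{0..l}. shifted_set M T (p j * int n + q j * int N) A)" for n N
  have "\<exists>m. \<exists>\<theta>>0. \<forall>(u :: nat \<Rightarrow> nat) v. \<exists>S\<subseteq>{..<m}. S \<noteq> {} \<and> \<theta> \<le> F (\<Sum>i\<in>S. u i) (\<Sum>i\<in>S. v i)"
    unfolding F_def by (rule recurrence_along_finite_sums[OF assms(1,3,9,10)])
  then obtain m \<theta> where "\<theta> > 0"
    and sums: "\<And>(u :: nat \<Rightarrow> nat) v. \<exists>S\<subseteq>{..<m}. S \<noteq> {} \<and> \<theta> \<le> F (\<Sum>i\<in>S. u i) (\<Sum>i\<in>S. v i)"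
    by blast
  define c where "c = \<theta> / 2 ^ (m + 2)"
  define \<N> where "\<N> = {N. N > 0 \<and> c \<le> 1 / real N * (\<Sum>n=1..N. F n N)}"
  have "\<exists>H. \<forall>a. \<exists>N\<in>{a..a + H}. N > 0 \<and> c \<le> 1 / real N * (\<Sum>n=1..N. F n N)"
    unfolding c_def by (rule syndetic_from_finite_sums[where F = F and m = m, OF _ \<open>\<theta> > 0\<close> sums]) (simp add: F_def)
  then obtain H where "\<And>a. \<exists>N\<in>{a..a + H}. N \<in> \<N>" unfolding \<N>_def by auto
  from syndetic_infinite_bounded_gaps[OF this] have "infinite \<N>" "uniformly_bounded_gaps \<N>" .
  moreover have "\<N> \<subseteq> {0<..}" by (auto simp: \<N>_def)
  moreover have "0 < Liminf (inf sequentially (principal \<N>)) (\<lambda>N. ereal (1 / real N * (\<Sum>n=1..N. F n N)))"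
  proof (rule less_le_trans)
    show "0 < ereal c" using \<open>\<theta> > 0\<close> by (simp add: c_def)
    show "ereal c \<le> Liminf (inf sequentially (principal \<N>)) (\<lambda>N. ereal (1 / real N * (\<Sum>n=1..N. F n N)))"
      by (intro Liminf_bounded) (simp add: eventually_inf_principal \<N>_def)
  qed
  ultimately have "\<N> \<subseteq> {0<..} \<and> infinite \<N> \<and> uniformly_bounded_gaps \<N> \<and>
      0 < Liminf (inf sequentially (principal \<N>)) (\<lambda>N. ereal (1 / real N * (\<Sum>n=1..N. F n N)))"
    by (intro conjI)
  then show ?thesis unfolding F_def by (rule exI)
qed

end
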